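(* Let $f$ be a non-negative Borel integrable function on $\mathbb{R}^n$, and let $c\in\mathbb{R}^n$ be a Yao-Yao center for the measure with density $f$ (with respect to Lebesgue measure). Then $c$ is a Santaló point for $f$ with respect to every weight $\rho$; that is, for every weight $\rho$ and every non-negative Borel function $g$ on $\mathbb{R}^n$ such that $$f(c+x)\,g(y)\leq \rho\bigl(\sqrt{x\cdot y}\bigr)^2\quad\text{for all } x,y\in\mathbb{R}^n \text{ with } x\cdot y\geq 0,$$ one has $$\int_{\mathbb{R}^n} f(x)\,dx\int_{\mathbb{R}^n} g(y)\,dy\leq\Bigl(\int_{\mathbb{R}^n}\rho(|x|)\,dx\Bigr)^2.$$
   Context: $x\cdot y$ is the standard scalar product and $|x|$ the Euclidean norm on $\mathbb{R}^n$. A weight is a measurable function $\rho:\mathbb{R}_+\to\mathbb{R}_+$ such that for every $n$ the function $x\in\mathbb{R}^n\mapsto\rho(|x|)$ is integrable. A set $\mathcal{P}$ of subsets of an affine space $E$ is a partition of $E$ if $\bigcup\mathcal{P}=E$ and the interiors of two distinct elements of $\mathcal{P}$ do not intersect. Yao-Yao partitions and their centers are defined by induction on the dimension of a finite-dimensional real affine space $E$ (with associated vector space $\vec{E}$): if $E=\{c\}$ has dimension $0$, then $\{\{c\}\}$ is a Yao-Yao partition of $E$ with center $c$. If $E$ has dimension $n\geq 1$, $\mathcal{P}$ is a Yao-Yao partition of $E$ if there exist an affine hyperplane $F$ of $E$, a vector $v\in\vec{E}\setminus\vec{F}$, and two Yao-Yao partitions $\mathcal{P}_+$, $\mathcal{P}_-$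 of $F$ having the same center $c$, such that $\mathcal{P}=\{A+\mathbb{R}_- v : A\in\mathcal{P}_-\}\cup\{A+\mathbb{R}_+ v : A\in\mathcal{P}_+\}$; the center of $\mathcal{P}$ is then $c$. For a finite Borel measure $\mu$ on $\mathbb{R}^n$ giving zero mass to every affine hyperplane, a Yao-Yao equipartition for $\mu$ is a Yao-Yao partition $\mathcal{P}$ of $\mathbb{R}^n$ with $\mu(A)=2^{-n}\mu(\mathbb{R}^n)$ for every $A\in\mathcal{P}$; a point $c$ is a Yao-Yao center of $\mu$ if it is the center of some Yao-Yao equipartition for $\mu$. *)

theory Defs
  imports "HOL-Analysis.Analysis"
begin

definition pos_ray_sum :: "'a::real_vector set \<Rightarrow> 'a \<Rightarrow> 'a set" where
  "pos_ray_sum A v = {a + t *\<^sub>R v | a t. a \<in> A \<and> t \<ge> 0}"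

definition neg_ray_sum :: "'a::real_vector set \<Rightarrow> 'a \<Rightarrow> 'a set" where
  "neg_ray_sum A v = {a + t *\<^sub>R v | a t. a \<in> A \<and> t \<le> 0}"

text \<open>yao_yao E P c: P is a Yao-Yao partition of the affine subspace E
  (of the ambient Euclidean space) with center c. Defined by induction on
  the dimension, as in the paper. For a point a of F (a subset of E),
  the conditions a + v in E and a + v not in F say that v lies in the
  direction space of E but not in that of F.\<close>
inductive yao_yao :: "'a::euclidean_space set \<Rightarrow> 'a set set \<Rightarrow> 'a \<Rightarrow> bool" where
  base: "yao_yao {c} {{c}} c"
| step: "\<lbrakk> affine E; aff_dim E \<ge> 1;
           affine F; F \<subseteq> E; aff_dim F = aff_dim E - 1;
           a \<in> F; a + v \<in> E; a + v \<notin> F;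
           yao_yao F Pm c; yao_yao F Pp c \<rbrakk>
   \<Longrightarrow> yao_yao E ((\<lambda>A. neg_ray_sum A v) ` Pm \<union> (\<lambda>A. pos_ray_sum A v) ` Pp) c"

definition yao_yao_equipartition :: "'a::euclidean_space measure \<Rightarrow> 'a set set \<Rightarrow> 'a \<Rightarrow> bool" where
  "yao_yao_equipartition M P c \<longleftrightarrow>
     yao_yao UNIV P c \<and> (\<forall>A\<in>P. emeasure M A = emeasure M UNIV / 2 ^ DIM('a))"

definition yao_yao_center :: "'a::euclidean_space measure \<Rightarrow> 'a \<Rightarrow> bool" where
  "yao_yao_center M c \<longleftrightarrow> (\<exists>P. yao_yao_equipartition M P c)"

definition weight :: "(real \<Rightarrow> real) \<Rightarrow> bool" where
  "weight \<rho> \<longleftrightarrow> \<rho> \<in> borel_measurable (restrict_space borel {0..})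
     \<and> (\<forall>r\<ge>0. \<rho> r \<ge> 0)
     \<and> (\<forall>n::nat. integrable (PiM {..<n} (\<lambda>_. lborel))
                   (\<lambda>x. \<rho> (sqrt (\<Sum>i<n. (x i)\<^sup>2))))"

end

theory Submission
  imports Defs
begin

text \<open>Each cell of a Yao-Yao partition centered at \<open>c\<close> is the image \<open>c + T(Q)\<close> of the nonnegative orthant
  \<open>Q\<close> under a linear isomorphism \<open>T\<close>, and its dual cone is \<open>S(Q)\<close> with \<open>S\<close> the contragredient of \<open>T\<close>.
  Since \<open>T x \<bullet> S y = x \<bullet> y\<close> and the Jacobians of \<open>T\<close> and \<open>S\<close> cancel, the Prekopa-Leindler inequality on
  \<open>Q\<close> in logarithmic coordinates bounds the product of the integral of \<open>f\<close> over the cell and the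
  integral of \<open>g\<close> over the dual cone by the square of the integral of \<open>\<rho>(|x|)\<close> over \<open>Q\<close>, that is, by
  \<open>4\<^sup>-\<^sup>n\<close> times the right-hand side. Every cell carries \<open>2\<^sup>-\<^sup>n\<close> of the mass of \<open>f\<close>, there are at most
  \<open>2\<^sup>n\<close> cells, and their dual cones cover the space, so summing over the cells gives the claim.\<close>

section \<open>The Prekopa-Leindler inequality on the line\<close>

text \<open>Cutting at points of \<open>A\<close> itself loses nothing in the limit: the thresholds
  \<open>u n\<close> increase to \<open>Sup A\<close>, or to infinity, and exhaust \<open>A\<close>
  up to the null set \<open>{Sup A}\<close>. Taking \<open>a\<close> inside \<open>A\<close> makes
  the translate of \<open>B\<close> by \<open>a\<close> available in the Brunn-Minkowski
  argument.\<close>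

lemma emeasure_le_SUP_lessThan:
  fixes A :: "real set"
  assumes [measurable]: "A \<in> sets borel" and "A \<noteq> {}"
  shows "emeasure lborel A \<le> (SUP a\<in>A. emeasure lborel (A \<inter> {..<a}))"
proof -
  define u where "u n = (if bdd_above A then Sup A - inverse (real (Suc n)) else real n)" for n
  \<comment> \<open>Each threshold is strictly below the supremum, so it can be replaced by a point
    of \<open>A\<close> to its right.\<close>
  have lt: "\<exists>a\<in>A. u n < a" for n
  proof (cases "bdd_above A")
    case True
    then show ?thesis using \<open>A \<noteq> {}\<close>
      by (simp add: u_def less_cSup_iff[symmetric])
  next
    case False
    then show ?thesis unfolding u_def bdd_above_def by (auto simp: not_le)
  qed
  have inc: "incseq (\<lambda>n. A \<inter> {..<u n})"
  proof (intro incseq_SucI subsetI)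
    fix n x assume "x \<in> A \<inter> {..<u n}"
    moreover have "u n \<le> u (Suc n)" by (simp add: u_def field_simps)
    ultimately show "x \<in> A \<inter> {..<u (Suc n)}" by auto
  qed
  have un: "A - {Sup A} \<subseteq> (\<Union>n. A \<inter> {..<u n})"
  proof
    fix x assume x: "x \<in> A - {Sup A}"
    have "\<exists>n. x < u n"
    proof (cases "bdd_above A")
      case True
      then have "x < Sup A" using x by (metis DiffD1 DiffD2 cSup_upper insertI1 less_eq_real_def)
      then obtain n where "inverse (real (Suc n)) < Sup A - x"
        using reals_Archimedean[of "Sup A - x"] by auto
      then show ?thesis using True by (auto simp: u_def intro!: exI[of _ n])
    next
      case False
      then show ?thesis using reals_Archimedean2 by (auto simp: u_def)
    qed
    then show "x \<in> (\<Union>n. A \<inter> {..<u n})" using x by auto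
  qed
  have "emeasure lborel A = emeasure lborel (A - {Sup A})"
    by (rule emeasure_Diff_null_set[symmetric]) (simp_all add: finite_imp_null_set_lborel)
  also have "\<dots> \<le> emeasure lborel (\<Union>n. A \<inter> {..<u n})"
    using un by (intro emeasure_mono) auto
  also have "\<dots> = (SUP n. emeasure lborel (A \<inter> {..<u n}))"
    using inc by (intro SUP_emeasure_incseq[symmetric]) auto
  also have "\<dots> \<le> (SUP a\<in>A. emeasure lborel (A \<inter> {..<a}))"
  proof (rule SUP_least)
    fix n
    obtain a where "a \<in> A" "u n < a" using lt by blast
    then show "emeasure lborel (A \<inter> {..<u n}) \<le> (SUP a\<in>A. emeasure lborel (A \<inter> {..<a}))"
      by (intro SUP_upper2[of a]) (auto intro!: emeasure_mono)
  qed
  finally show ?thesis .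
qed

lemma emeasure_lborel_affine_vimage:
  fixes A :: "real set" and m t :: real
  assumes [measurable]: "A \<in> sets borel" and "m \<noteq> 0"
  shows "emeasure lborel A = ennreal \<bar>m\<bar> * emeasure lborel ((\<lambda>x. t + m * x) -` A)"
proof -
  have "emeasure lborel A = emeasure (density (distr lborel borel (\<lambda>x. t + m * x)) (\<lambda>_. ennreal \<bar>m\<bar>)) A"
    using lborel_real_affine[OF \<open>m \<noteq> 0\<close>, of t] by simp
  also have "\<dots> = ennreal \<bar>m\<bar> * emeasure lborel ((\<lambda>x. t + m * x) -` A)"
    by (simp add: emeasure_density nn_integral_cmult emeasure_distr)
  finally show ?thesis .
qed

text \<open>Follows from the left-hand version by reflecting the line.\<close>

lemma emeasure_le_SUP_greaterThan:
  fixes A :: "real set"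
  assumes [measurable]: "A \<in> sets borel" and "A \<noteq> {}"
  shows "emeasure lborel A \<le> (SUP a\<in>A. emeasure lborel (A \<inter> {a<..}))"
proof -
  define B where "B = uminus -` A"
  have [measurable]: "B \<in> sets borel"
    unfolding B_def by (rule measurable_sets_borel[OF _ assms(1)]) simp
  have reflect: "emeasure lborel X = emeasure lborel (uminus -` X)" if "X \<in> sets borel" for X :: "real set"
    using emeasure_lborel_affine_vimage[OF that, of "-1" 0] by simp
  have "B \<noteq> {}" using assms(2) unfolding B_def by (metis Compl_UNIV_eq empty_Diff ex_in_conv minus_minus vimageI)
  have "emeasure lborel A = emeasure lborel B" by (simp add: reflect[of A] B_def)
  also have "\<dots> \<le> (SUP b\<in>B. emeasure lborel (B \<inter> {..<b}))"
    using \<open>B \<noteq> {}\<close> by (intro emeasure_le_SUP_lessThan) auto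
  also have "\<dots> \<le> (SUP a\<in>A. emeasure lborel (A \<inter> {a<..}))"
  proof (rule SUP_least)
    fix b assume "b \<in> B"
    have "emeasure lborel (A \<inter> {-b<..}) = emeasure lborel (B \<inter> {..<b})"
      by (subst reflect) (auto simp: B_def intro!: arg_cong[where f="emeasure lborel"])
    then show "emeasure lborel (B \<inter> {..<b}) \<le> (SUP a\<in>A. emeasure lborel (A \<inter> {a<..}))"
      using \<open>b \<in> B\<close> by (intro SUP_upper2[of "-b"]) (auto simp: B_def)
  qed
  finally show ?thesis .
qed

text \<open>Shift the part of \<open>A\<close> left of \<open>a\<close> by \<open>b\<close> and the
  part of \<open>B\<close> right of \<open>b\<close> by \<open>a\<close>. The translates lie on
  opposite sides of \<open>a + b\<close>, so they are disjoint, and both consist of sums, hence lie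
  in the double \<open>D\<close> of \<open>C\<close>. Working inside this Borel set avoids the
  question whether the sumset is measurable.\<close>

lemma brunn_minkowski_midpoint:
  fixes A B C :: "real set"
  assumes [measurable]: "A \<in> sets borel" "B \<in> sets borel" "C \<in> sets borel"
    and ne: "A \<noteq> {}" "B \<noteq> {}"
    and mid: "\<And>a b. a \<in> A \<Longrightarrow> b \<in> B \<Longrightarrow> (a + b) / 2 \<in> C"
  shows "emeasure lborel A + emeasure lborel B \<le> 2 * emeasure lborel C"
proof -
  define D where "D = (\<lambda>x. x / 2) -` C"
  have [measurable]: "D \<in> sets borel"
    unfolding D_def by (rule measurable_sets_borel[OF _ assms(3)]) simp
  have D: "emeasure lborel D = 2 * emeasure lborel C"
    using emeasure_lborel_affine_vimage[of D 2 0] by (simp add: D_def vimage_def)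
  have piece: "emeasure lborel (A \<inter> {..<a}) + emeasure lborel (B \<inter> {b<..}) \<le> emeasure lborel D"
    if "a \<in> A" "b \<in> B" for a b
  proof -
    let ?X = "(\<lambda>x. - b + 1 * x) -` (A \<inter> {..<a})" and ?Y = "(\<lambda>x. - a + 1 * x) -` (B \<inter> {b<..})"
    have [measurable]: "?X \<in> sets borel" "?Y \<in> sets borel"
      by (rule measurable_sets_borel[of _ borel]; measurable)+
    have "emeasure lborel (A \<inter> {..<a}) + emeasure lborel (B \<inter> {b<..})
        = emeasure lborel ?X + emeasure lborel ?Y"
      by (subst (1) emeasure_lborel_affine_vimage[of _ 1 "-b"], simp, simp,
          subst (2) emeasure_lborel_affine_vimage[of _ 1 "-a"]) auto
    also have "\<dots> = emeasure lborel (?X \<union> ?Y)"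
      by (intro plus_emeasure) auto
    also have "\<dots> \<le> emeasure lborel D"
    proof (intro emeasure_mono subsetI)
      fix x assume "x \<in> ?X \<union> ?Y"
      then show "x \<in> D"
        using mid[of "x - b" b] mid[of a "x - a"] that by (auto simp: D_def)
    qed simp
    finally show ?thesis .
  qed
  have "emeasure lborel A + emeasure lborel B
      \<le> (SUP a\<in>A. emeasure lborel (A \<inter> {..<a})) + (SUP b\<in>B. emeasure lborel (B \<inter> {b<..}))"
    using ne by (intro add_mono emeasure_le_SUP_lessThan emeasure_le_SUP_greaterThan) auto
  \<comment> \<open>The bound \<open>piece\<close> holds for \<open>a\<close> and \<open>b\<close>
    independently; nonemptiness lets the sum pass through both suprema.\<close>
  also have "\<dots> = (SUP b\<in>B. SUP a\<in>A. emeasure lborel (A \<inter> {..<a}) + emeasure lborel (B \<inter> {b<..}))"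
    using ne by (simp add: ennreal_SUP_add_left ennreal_SUP_add_right)
  also have "\<dots> \<le> emeasure lborel D"
    by (intro SUP_least piece)
  finally show ?thesis by (simp add: D)
qed

text \<open>Tonelli on the region under the graph. Levels stop at 1 because superlevel sets of a
  function with supremum 1 are nonempty only below it, and Brunn-Minkowski needs nonempty sets; the
  price is the truncation at 1.\<close>

lemma nn_integral_layer_cake_unit:
  fixes f :: "real \<Rightarrow> ennreal"
  assumes [measurable]: "f \<in> borel_measurable borel"
  shows "(\<integral>\<^sup>+t. emeasure lborel {x. ennreal t < f x} * indicator {0<..<1} t \<partial>lborel)
       = (\<integral>\<^sup>+x. min 1 (f x) \<partial>lborel)"
proof -
  have slice: "(\<integral>\<^sup>+t. indicator {x. ennreal t < f x} x * indicator {0<..<1} t \<partial>lborel) = min 1 (f x)" for x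
  proof -
    have "(\<integral>\<^sup>+t. indicator {x. ennreal t < f x} x * indicator {0<..<1} t \<partial>lborel)
        = (\<integral>\<^sup>+t. indicator {0<..<enn2real (min 1 (f x))} t \<partial>lborel)"
    proof (intro nn_integral_cong)
      fix t :: real
      have "ennreal t < f x \<and> t < 1 \<longleftrightarrow> t < enn2real (min 1 (f x))" if "0 < t"
      proof -
        \<comment> \<open>The truncated value is finite, so \<open>enn2real\<close> preserves the
          comparison with \<open>t\<close>.\<close>
        have "min 1 (f x) < top" by (simp add: min_less_iff_disj)
        then have "t < enn2real (min 1 (f x)) \<longleftrightarrow> ennreal t < min 1 (f x)"
          using that by (metis enn2real_nonneg ennreal_enn2real ennreal_less_iff less_imp_le)
        also have "\<dots> \<longleftrightarrow> ennreal t < f x \<and> t < 1"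
          using that by (auto simp: ennreal_less_one_iff)
        finally show ?thesis by blast
      qed
      then show "indicator {x. ennreal t < f x} x * indicator {0<..<1} t
          = (indicator {0<..<enn2real (min 1 (f x))} t :: ennreal)"
        by (auto split: split_indicator)
    qed
    also have "\<dots> = min 1 (f x)"
      by (simp add: min_less_iff_disj)
    finally show ?thesis .
  qed
  have "(\<integral>\<^sup>+t. emeasure lborel {x. ennreal t < f x} * indicator {0<..<1} t \<partial>lborel)
      = (\<integral>\<^sup>+t. \<integral>\<^sup>+x. indicator {x. ennreal t < f x} x * indicator {0<..<1} t \<partial>lborel \<partial>lborel)"
    by (intro nn_integral_cong) (simp add: nn_integral_multc)
  also have "\<dots> = (\<integral>\<^sup>+x. \<integral>\<^sup>+t. indicator {x. ennreal t < f x} x * indicator {0<..<1} t \<partial>lborel \<partial>lborel)"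
    by (rule lborel_pair.Fubini') simp
  also have "\<dots> = (\<integral>\<^sup>+x. min 1 (f x) \<partial>lborel)"
    by (simp add: slice)
  finally show ?thesis .
qed

text \<open>For \<open>0 < t < 1\<close> the superlevel sets of \<open>f\<close> and
  \<open>g\<close> are nonempty, and midpoints of their points lie in that of \<open>h\<close>
  because \<open>f x * g y\<close> exceeds the square of \<open>t\<close>. Brunn-Minkowski at each
  level, integrated over \<open>t\<close>, gives an additive bound, which implies the product form
  by AM-GM.\<close>

lemma prekopa_leindler_normalized:
  fixes f g h :: "real \<Rightarrow> ennreal"
  assumes [measurable]: "f \<in> borel_measurable borel" "g \<in> borel_measurable borel" "h \<in> borel_measurable borel"
    and sup: "(SUP x. f x) = 1" "(SUP x. g x) = 1"
    and le: "\<And>x y. f x * g y \<le> (h ((x + y) / 2))\<^sup>2"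
  shows "(\<integral>\<^sup>+x. f x \<partial>lborel) + (\<integral>\<^sup>+x. g x \<partial>lborel) \<le> 2 * (\<integral>\<^sup>+x. h x \<partial>lborel)"
proof -
  have le1: "f x \<le> 1" "g x \<le> 1" for x
    using SUP_upper[of x UNIV f] SUP_upper[of x UNIV g] sup by auto
  let ?L = "\<lambda>(f :: real \<Rightarrow> ennreal) t. emeasure lborel {x. ennreal t < f x} * indicator {0<..<1} t"
  have bm: "?L f t + ?L g t \<le> 2 * ?L h t" for t :: real
  proof (cases "0 < t \<and> t < 1")
    case True
    then have t1: "ennreal t < 1" by (simp add: ennreal_less_one_iff)
    have "{x. ennreal t < f x} \<noteq> {}" "{x. ennreal t < g x} \<noteq> {}"
      using t1 sup less_SUP_iff[of "ennreal t" f UNIV] less_SUP_iff[of "ennreal t" g UNIV] by auto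
    moreover have "ennreal t < h ((x + y) / 2)" if "ennreal t < f x" "ennreal t < g y" for x y
    proof (rule ccontr)
      assume "\<not> ennreal t < h ((x + y) / 2)"
      then have "(h ((x + y) / 2))\<^sup>2 \<le> (ennreal t)\<^sup>2"
        by (intro power_mono) auto
      also have "\<dots> < f x * ennreal t"
        unfolding power2_eq_square using that True by (intro ennreal_mult_strict_right_mono) auto
      also have "\<dots> \<le> f x * g y"
        using that by (intro mult_left_mono) auto
      finally show False using le[of x y] by simp
    qed
    ultimately have "emeasure lborel {x. ennreal t < f x} + emeasure lborel {x. ennreal t < g x}
        \<le> 2 * emeasure lborel {x. ennreal t < h x}"
      by (intro brunn_minkowski_midpoint) auto
    then show ?thesis using True by simp
  qed auto
  have "(\<integral>\<^sup>+x. f x \<partial>lborel) + (\<integral>\<^sup>+x. g x \<partial>lborel)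
      = (\<integral>\<^sup>+t. ?L f t \<partial>lborel) + (\<integral>\<^sup>+t. ?L g t \<partial>lborel)"
    using le1 by (simp add: nn_integral_layer_cake_unit min_absorb2)
  also have "\<dots> = (\<integral>\<^sup>+t. ?L f t + ?L g t \<partial>lborel)"
    by (rule nn_integral_add[symmetric]) measurable
  also have "\<dots> \<le> (\<integral>\<^sup>+t. 2 * ?L h t \<partial>lborel)"
    by (intro nn_integral_mono bm)
  also have "\<dots> = 2 * (\<integral>\<^sup>+t. ?L h t \<partial>lborel)"
    by (rule nn_integral_cmult) measurable
  also have "(\<integral>\<^sup>+t. ?L h t \<partial>lborel) = (\<integral>\<^sup>+x. min 1 (h x) \<partial>lborel)"
    by (rule nn_integral_layer_cake_unit) simp
  \<comment> \<open>\<open>h\<close> may exceed 1, but truncating it only lowers the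
    integral.\<close>
  also have "2 * \<dots> \<le> 2 * (\<integral>\<^sup>+x. h x \<partial>lborel)"
    by (intro mult_left_mono nn_integral_mono) auto
  finally show ?thesis .
qed

text \<open>AM-GM: on finite values it comes from \<open>0 \<le> (p' - q')\<^sup>2\<close>, and for
  \<open>c = top\<close> it is trivial.\<close>

lemma ennreal_mult_le_square_mean:
  fixes p q c :: ennreal
  assumes "p + q \<le> 2 * c"
  shows "p * q \<le> c\<^sup>2"
proof (cases "c = top")
  case True
  then show ?thesis by (simp add: power2_eq_square ennreal_top_mult)
next
  case False
  then obtain c' where c: "c = ennreal c'" "c' \<ge> 0" by (cases c) auto
  have "2 * c < top" using False by (simp add: ennreal_mult_less_top less_top)
  then have "p + q < top" using assms by (rule le_less_trans[rotated])
  then obtain p' q' where pq: "p = ennreal p'" "p' \<ge> 0" "q = ennreal q'" "q' \<ge> 0"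
    by (cases p; cases q) (auto simp: ennreal_add_eq_top)
  have "p' + q' \<le> 2 * c'"
    using assms c pq by (simp flip: ennreal_plus ennreal_numeral ennreal_mult)
  then have "(p' + q')\<^sup>2 \<le> (2 * c')\<^sup>2"
    using pq by (intro power_mono) auto
  moreover have "4 * (p' * q') \<le> (p' + q')\<^sup>2"
    using zero_le_power2[of "p' - q'"] by (simp add: power2_eq_square algebra_simps)
  ultimately have "p' * q' \<le> c'\<^sup>2" by (simp add: power2_eq_square)
  then show ?thesis using c pq by (simp add: ennreal_power flip: ennreal_mult)
qed

text \<open>Hypothesis and conclusion are homogeneous: dividing \<open>f\<close> and
  \<open>g\<close> by their suprema \<open>m\<close> and \<open>n\<close>, and \<open>h\<close> by
  \<open>sqrt (m * n)\<close>, leads to the normalized case.\<close>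

lemma prekopa_leindler_bounded:
  fixes f g h :: "real \<Rightarrow> ennreal"
  assumes [measurable]: "f \<in> borel_measurable borel" "g \<in> borel_measurable borel" "h \<in> borel_measurable borel"
    and bdd: "(SUP x. f x) < top" "(SUP x. g x) < top"
    and le: "\<And>x y. f x * g y \<le> (h ((x + y) / 2))\<^sup>2"
  shows "(\<integral>\<^sup>+x. f x \<partial>lborel) * (\<integral>\<^sup>+x. g x \<partial>lborel) \<le> (\<integral>\<^sup>+x. h x \<partial>lborel)\<^sup>2"
proof (cases "(SUP x. f x) = 0 \<or> (SUP x. g x) = 0")
  case True
  then have "(\<forall>x. f x = 0) \<or> (\<forall>x. g x = 0)" by (auto simp: SUP_eq_iff bot_ennreal)
  then show ?thesis by auto
next
  case False
  obtain m where m: "(SUP x. f x) = ennreal m" "m > 0"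
    using bdd(1) False by (cases "SUP x. f x") (auto simp: less_le)
  obtain n where n: "(SUP x. g x) = ennreal n" "n > 0"
    using bdd(2) False by (cases "SUP x. g x") (auto simp: less_le)
  define r where "r = sqrt (m * n)"
  have r: "r > 0" "r\<^sup>2 = m * n" using m n by (auto simp: r_def)
  have inv: "ennreal (1 / m) * ennreal (1 / n) = (ennreal (1 / r))\<^sup>2"
    using m n r by (simp add: ennreal_power power_divide flip: ennreal_mult)
  let ?f = "\<lambda>x. ennreal (1 / m) * f x" and ?g = "\<lambda>x. ennreal (1 / n) * g x"
    and ?h = "\<lambda>x. ennreal (1 / r) * h x"
  have "(\<integral>\<^sup>+x. ?f x \<partial>lborel) + (\<integral>\<^sup>+x. ?g x \<partial>lborel) \<le> 2 * (\<integral>\<^sup>+x. ?h x \<partial>lborel)"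
  proof (rule prekopa_leindler_normalized)
    show "(SUP x. ?f x) = 1" "(SUP x. ?g x) = 1"
      using m n by (simp_all flip: SUP_mult_left_ennreal ennreal_mult)
    fix x y
    have "?f x * ?g y = (ennreal (1 / m) * ennreal (1 / n)) * (f x * g y)" by (simp add: mult_ac)
    also have "\<dots> \<le> (ennreal (1 / m) * ennreal (1 / n)) * (h ((x + y) / 2))\<^sup>2"
      by (intro mult_left_mono le) simp
    also have "\<dots> = (?h ((x + y) / 2))\<^sup>2" by (simp only: inv power_mult_distrib)
    finally show "?f x * ?g y \<le> (?h ((x + y) / 2))\<^sup>2" .
  qed measurable
  then have "(\<integral>\<^sup>+x. ?f x \<partial>lborel) * (\<integral>\<^sup>+x. ?g x \<partial>lborel) \<le> (\<integral>\<^sup>+x. ?h x \<partial>lborel)\<^sup>2"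
    by (rule ennreal_mult_le_square_mean)
  then have "(ennreal (1 / m) * ennreal (1 / n)) * ((\<integral>\<^sup>+x. f x \<partial>lborel) * (\<integral>\<^sup>+x. g x \<partial>lborel))
      \<le> (ennreal (1 / r))\<^sup>2 * (\<integral>\<^sup>+x. h x \<partial>lborel)\<^sup>2"
    by (subst (asm) (1 2 3) nn_integral_cmult) (simp_all add: power_mult_distrib mult_ac)
  \<comment> \<open>The scaling is undone by multiplying with the square of \<open>r\<close> rather
    than by cancelling, since the integrals may be infinite.\<close>
  then have scaled: "(ennreal r)\<^sup>2 * ((ennreal (1 / r))\<^sup>2 * ((\<integral>\<^sup>+x. f x \<partial>lborel) * (\<integral>\<^sup>+x. g x \<partial>lborel)))
      \<le> (ennreal r)\<^sup>2 * ((ennreal (1 / r))\<^sup>2 * (\<integral>\<^sup>+x. h x \<partial>lborel)\<^sup>2)"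
    unfolding inv by (rule mult_left_mono) simp
  have "(ennreal r)\<^sup>2 * (ennreal (1 / r))\<^sup>2 = 1"
    using r by (simp flip: power_mult_distrib ennreal_mult)
  with scaled show ?thesis by (simp only: mult.assoc[symmetric] mult_1)
qed

lemma nn_integral_SUP_truncate:
  assumes [measurable]: "f \<in> borel_measurable M"
  shows "(\<integral>\<^sup>+x. f x \<partial>M) = (SUP k. \<integral>\<^sup>+x. min (f x) (of_nat k) \<partial>M)"
proof -
  have sup: "f x = (SUP k. min (f x) (of_nat k))" for x
    by (simp add: ennreal_SUP_of_nat_eq_top flip: inf_min inf_SUP)
  have "(\<integral>\<^sup>+x. f x \<partial>M) = (\<integral>\<^sup>+x. (SUP k. min (f x) (of_nat k)) \<partial>M)"
    by (rule nn_integral_cong) (rule sup)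
  also have "\<dots> = (SUP k. \<integral>\<^sup>+x. min (f x) (of_nat k) \<partial>M)"
    by (intro nn_integral_monotone_convergence_SUP)
      (auto simp: incseq_def le_fun_def intro!: min.mono intro: order_trans[OF min.cobounded2])
  finally show ?thesis .
qed

text \<open>Cutting off \<open>f\<close> and \<open>g\<close> at levels \<open>k\<close> and
  \<open>l\<close> keeps the hypothesis with the same \<open>h\<close>, so the bounded case applies;
  monotone convergence then removes both cutoffs.\<close>

theorem prekopa_leindler_real:
  fixes f g h :: "real \<Rightarrow> ennreal"
  assumes [measurable]: "f \<in> borel_measurable borel" "g \<in> borel_measurable borel" "h \<in> borel_measurable borel"
    and le: "\<And>x y. f x * g y \<le> (h ((x + y) / 2))\<^sup>2"
  shows "(\<integral>\<^sup>+x. f x \<partial>lborel) * (\<integral>\<^sup>+x. g x \<partial>lborel) \<le> (\<integral>\<^sup>+x. h x \<partial>lborel)\<^sup>2"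
proof -
  have "(\<integral>\<^sup>+x. min (f x) (of_nat k) \<partial>lborel) * (\<integral>\<^sup>+x. min (g x) (of_nat l) \<partial>lborel)
      \<le> (\<integral>\<^sup>+x. h x \<partial>lborel)\<^sup>2" for k l :: nat
  proof (rule prekopa_leindler_bounded)
    show "(SUP x. min (f x) (of_nat k)) < top" "(SUP x. min (g x) (of_nat l)) < top"
      by (rule le_less_trans[OF SUP_least[where u="of_nat k"]], simp, simp add: of_nat_less_top,
          rule le_less_trans[OF SUP_least[where u="of_nat l"]], simp, simp add: of_nat_less_top)
    show "min (f x) (of_nat k) * min (g y) (of_nat l) \<le> (h ((x + y) / 2))\<^sup>2" for x y
      by (rule order_trans[OF mult_mono le]) auto
  qed measurable
  then show ?thesis
    by (auto simp: nn_integral_SUP_truncate[of f] nn_integral_SUP_truncate[of g] SUP_mult_left_ennreal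
        SUP_mult_right_ennreal intro!: SUP_least)
qed

text \<open>The substitution is made on compact intervals from \<open>exp (- k)\<close> to
  \<open>exp k\<close>, which increase to the open half-line; the missing point 0 is null.\<close>

lemma nn_integral_exp_substitution:
  fixes f :: "real \<Rightarrow> ennreal"
  assumes [measurable]: "f \<in> borel_measurable borel"
  shows "(\<integral>\<^sup>+x. f x * indicator {0..} x \<partial>lborel) = (\<integral>\<^sup>+s. f (exp s) * ennreal (exp s) \<partial>lborel)"
proof -
  have "(\<integral>\<^sup>+x. f x * indicator {0..} x \<partial>lborel)
      = (\<integral>\<^sup>+x. (SUP k. f x * indicator {exp (- real k)..exp (real k)} x) \<partial>lborel)"
  proof (rule nn_integral_cong_AE, use AE_lborel_singleton[of 0] in eventually_elim)
    fix x :: real assume "x \<noteq> 0"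
    have "(SUP k. f x * indicator {exp (- real k)..exp (real k)} x) = f x" if "x > 0"
    proof (rule antisym[OF SUP_least])
      obtain k where "\<bar>ln x\<bar> \<le> real k" using real_arch_simple by blast
      then have "exp (- real k) \<le> exp (ln x)" "exp (ln x) \<le> exp (real k)" by (subst exp_le_cancel_iff; linarith)+
      then show "f x \<le> (SUP k. f x * indicator {exp (- real k)..exp (real k)} x)"
        using that by (intro SUP_upper2[of k]) auto
    qed (auto split: split_indicator)
    moreover have "(SUP k. f x * indicator {exp (- real k)..exp (real k)} x) = 0" if "x < 0"
    proof -
      have "\<not> exp (- real k) \<le> x" for k using exp_gt_zero[of "- real k"] that by linarith
      then show ?thesis by simp
    qed
    ultimately show "f x * indicator {0..} x = (SUP k. f x * indicator {exp (- real k)..exp (real k)} x)"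
      using \<open>x \<noteq> 0\<close> by (cases "x > 0") auto
  qed
  also have "\<dots> = (SUP k. \<integral>\<^sup>+x. f x * indicator {exp (- real k)..exp (real k)} x \<partial>lborel)"
    by (intro nn_integral_monotone_convergence_SUP)
      (auto simp: incseq_def le_fun_def split: split_indicator, (meson exp_le_cancel_iff neg_le_iff_le of_nat_le_iff order_trans)+)
  also have "\<dots> = (SUP k. \<integral>\<^sup>+s. f (exp s) * ennreal (exp s) * indicator {- real k..real k} s \<partial>lborel)"
  proof (intro SUP_cong refl)
    fix k :: nat
    show "(\<integral>\<^sup>+x. f x * indicator {exp (- real k)..exp (real k)} x \<partial>lborel)
        = (\<integral>\<^sup>+s. f (exp s) * ennreal (exp s) * indicator {- real k..real k} s \<partial>lborel)"
    \<comment> \<open>For \<open>k = 0\<close> both intervals shrink to a point and both integrals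
      vanish; the substitution rule is used on nondegenerate intervals only.\<close>
    proof (cases "k = 0")
      case True
      have "(\<integral>\<^sup>+x. F x * indicator {a..a} x \<partial>lborel) = 0" for F :: "real \<Rightarrow> ennreal" and a
        using AE_lborel_singleton[of a]
        by (subst nn_integral_cong_AE[where v="\<lambda>_. 0"]) (erule eventually_mono, auto)
      then show ?thesis using True by simp
    next
      case False
      then show ?thesis
        by (intro nn_integral_substitution_aux) (auto intro!: derivative_eq_intros continuous_intros)
    qed
  qed
  also have "\<dots> = (\<integral>\<^sup>+s. (SUP k. f (exp s) * ennreal (exp s) * indicator {- real k..real k} s) \<partial>lborel)"
    by (intro nn_integral_monotone_convergence_SUP[symmetric])
      (auto simp: incseq_def le_fun_def split: split_indicator)
  also have "\<dots> = (\<integral>\<^sup>+s. f (exp s) * ennreal (exp s) \<partial>lborel)"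
  proof (rule nn_integral_cong, rule antisym[OF SUP_least])
    fix s :: real
    obtain k where "\<bar>s\<bar> \<le> real k" using real_arch_simple by blast
    then show "f (exp s) * ennreal (exp s) \<le> (SUP k. f (exp s) * ennreal (exp s) * indicator {- real k..real k} s)"
      by (intro SUP_upper2[of k]) (auto simp: abs_le_iff)
  qed (auto split: split_indicator)
  finally show ?thesis .
qed

text \<open>In the variables \<open>x = exp s\<close> and \<open>y = exp t\<close> the geometric
  mean becomes the midpoint, and the Jacobians satisfy
  \<open>exp s * exp t = (exp ((s + t) / 2))\<^sup>2\<close>, so they can be absorbed into the three
  functions.\<close>

lemma prekopa_leindler_half_line:
  fixes f g h :: "real \<Rightarrow> ennreal"
  assumes [measurable]: "f \<in> borel_measurable borel" "g \<in> borel_measurable borel" "h \<in> borel_measurable borel"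
    and le: "\<And>x y. x \<ge> 0 \<Longrightarrow> y \<ge> 0 \<Longrightarrow> f x * g y \<le> (h (sqrt (x * y)))\<^sup>2"
  shows "(\<integral>\<^sup>+x. f x * indicator {0..} x \<partial>lborel) * (\<integral>\<^sup>+x. g x * indicator {0..} x \<partial>lborel)
    \<le> (\<integral>\<^sup>+x. h x * indicator {0..} x \<partial>lborel)\<^sup>2"
proof -
  have "f (exp s) * ennreal (exp s) * (g (exp t) * ennreal (exp t))
      \<le> (h (exp ((s + t) / 2)) * ennreal (exp ((s + t) / 2)))\<^sup>2" for s t
  proof -
    have e: "exp s * exp t = (exp ((s + t) / 2))\<^sup>2"
      by (simp add: power2_eq_square flip: exp_add)
    then have "sqrt (exp s * exp t) = exp ((s + t) / 2)" by simp
    then have "f (exp s) * g (exp t) \<le> (h (exp ((s + t) / 2)))\<^sup>2"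
      using le[of "exp s" "exp t"] by simp
    moreover have "ennreal (exp s) * ennreal (exp t) = (ennreal (exp ((s + t) / 2)))\<^sup>2"
      by (simp add: ennreal_power e flip: ennreal_mult)
    ultimately have "(f (exp s) * g (exp t)) * (ennreal (exp s) * ennreal (exp t))
        \<le> (h (exp ((s + t) / 2)))\<^sup>2 * (ennreal (exp ((s + t) / 2)))\<^sup>2"
      by (intro mult_mono) auto
    then show ?thesis by (simp add: power_mult_distrib mult_ac)
  qed
  then show ?thesis
    by (subst (1 2 3) nn_integral_exp_substitution) (auto intro!: prekopa_leindler_real)
qed

section \<open>The Prekopa-Leindler inequality on the orthant\<close>

abbreviation "nonneg_coords I \<equiv> {x :: 'i \<Rightarrow> real. \<forall>i\<in>I. 0 \<le> x i}"

lemma nn_integral_PiM_insert_nonneg: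
  fixes F :: "('i \<Rightarrow> real) \<Rightarrow> ennreal"
  assumes "finite I" "i \<notin> I"
    and [measurable]: "F \<in> borel_measurable (PiM (insert i I) (\<lambda>_. lborel))"
  shows "(\<integral>\<^sup>+x. F x * indicator (nonneg_coords (insert i I)) x \<partial>PiM (insert i I) (\<lambda>_. lborel))
    = (\<integral>\<^sup>+a. (\<integral>\<^sup>+x. F (x(i := a)) * indicator (nonneg_coords I) x \<partial>PiM I (\<lambda>_. lborel))
          * indicator {0..} a \<partial>lborel)"
proof -
  interpret product_sigma_finite "\<lambda>_::'i. lborel :: real measure" ..
  note [simp] = \<open>finite I\<close>
  have "(\<integral>\<^sup>+x. F x * indicator (nonneg_coords (insert i I)) x \<partial>PiM (insert i I) (\<lambda>_. lborel))
    = (\<integral>\<^sup>+a. \<integral>\<^sup>+x. F (x(i := a)) * indicator (nonneg_coords (insert i I)) (x(i := a)) \<partial>PiM I (\<lambda>_. lborel) \<partial>lborel)"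
    using assms by (intro product_nn_integral_insert_rev) auto
  also have "\<dots> = (\<integral>\<^sup>+a. \<integral>\<^sup>+x. F (x(i := a)) * indicator (nonneg_coords I) x * indicator {0..} a
      \<partial>PiM I (\<lambda>_. lborel) \<partial>lborel)"
    using \<open>i \<notin> I\<close> by (intro nn_integral_cong) (auto split: split_indicator)
  also have "\<dots> = (\<integral>\<^sup>+a. (\<integral>\<^sup>+x. F (x(i := a)) * indicator (nonneg_coords I) x \<partial>PiM I (\<lambda>_. lborel))
          * indicator {0..} a \<partial>lborel)"
    by (intro nn_integral_cong nn_integral_multc) measurable
  finally show ?thesis .
qed

text \<open>Puts the new coordinate first, matching iterated integrals whose outer variable is
  \<open>a\<close>.\<close>

lemma measurable_fun_upd_swapped:
  "(\<lambda>(a, x). x(i := a)) \<in> lborel \<Otimes>\<^sub>M PiM I (\<lambda>_. lborel) \<rightarrow>\<^sub>M PiM (insert i I) (\<lambda>_. lborel)"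
  using measurable_add_dim[of i I "\<lambda>_. lborel"] measurable_pair_swap'
  by (auto intro: measurable_compose simp: case_prod_beta')

text \<open>Induction over the coordinates: for fixed \<open>a\<close> and \<open>b\<close> the
  induction hypothesis, applied to slices, shows that the marginals \<open>?J\<close> satisfy the
  hypothesis on the half-line, with \<open>sqrt (a * b)\<close> as the new coordinate of the mean.
  Arguments are extensional because the points of a product space are.\<close>

theorem prekopa_leindler_PiM_nonneg:
  fixes F G H :: "('i \<Rightarrow> real) \<Rightarrow> ennreal"
  assumes "finite I"
    and "F \<in> borel_measurable (PiM I (\<lambda>_. lborel))" "G \<in> borel_measurable (PiM I (\<lambda>_. lborel))"
      "H \<in> borel_measurable (PiM I (\<lambda>_. lborel))"
    and "\<And>x y. x \<in> nonneg_coords I \<inter> extensional I \<Longrightarrow> y \<in> nonneg_coords I \<inter> extensional I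
      \<Longrightarrow> F x * G y \<le> (H (\<lambda>i\<in>I. sqrt (x i * y i)))\<^sup>2"
  shows "(\<integral>\<^sup>+x. F x * indicator (nonneg_coords I) x \<partial>PiM I (\<lambda>_. lborel))
      * (\<integral>\<^sup>+x. G x * indicator (nonneg_coords I) x \<partial>PiM I (\<lambda>_. lborel))
    \<le> (\<integral>\<^sup>+x. H x * indicator (nonneg_coords I) x \<partial>PiM I (\<lambda>_. lborel))\<^sup>2"
  using assms
proof (induction I arbitrary: F G H rule: finite_induct)
  case empty
  then show ?case
    by (simp add: PiM_empty nn_integral_count_space_finite)
next
  case (insert i I)
  note [measurable] = insert.prems(1-3)
  note [simp] = insert.hyps
  interpret product_sigma_finite "\<lambda>_::'i. lborel :: real measure" ..
  interpret finite_product_sigma_finite "\<lambda>_::'i. lborel :: real measure" I by standard simp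
  let ?J = "\<lambda>F a. \<integral>\<^sup>+x. F (x(i := a)) * indicator (nonneg_coords I) x \<partial>PiM I (\<lambda>_. lborel)"
  note [measurable] = measurable_fun_upd_swapped[of i I]
  have meas: "?J F \<in> borel_measurable borel"
    if [measurable]: "F \<in> borel_measurable (PiM (insert i I) (\<lambda>_. lborel))" for F :: "('i \<Rightarrow> real) \<Rightarrow> ennreal"
    by measurable
  have "?J F a * ?J G b \<le> (?J H (sqrt (a * b)))\<^sup>2" if ab: "a \<ge> 0" "b \<ge> 0" for a b
  proof (rule insert.IH)
    fix x y assume xy: "x \<in> nonneg_coords I \<inter> extensional I" "y \<in> nonneg_coords I \<inter> extensional I"
    have "F (x(i := a)) * G (y(i := b))
        \<le> (H (\<lambda>j\<in>insert i I. sqrt ((x(i := a)) j * (y(i := b)) j)))\<^sup>2"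
      using xy ab by (intro insert.prems(4)) (auto simp: extensional_def)
    also have "(\<lambda>j\<in>insert i I. sqrt ((x(i := a)) j * (y(i := b)) j)) = (\<lambda>j\<in>I. sqrt (x j * y j))(i := sqrt (a * b))"
      by (auto simp: fun_eq_iff)
    finally show "F (x(i := a)) * G (y(i := b)) \<le> (H ((\<lambda>j\<in>I. sqrt (x j * y j))(i := sqrt (a * b))))\<^sup>2" .
  qed measurable
  then show ?case
    by (subst (1 2 3) nn_integral_PiM_insert_nonneg)
      (auto intro!: prekopa_leindler_half_line meas)
qed

section \<open>Even integrands: from the orthant to the whole space\<close>

lemma nn_integral_even_real:
  fixes h :: "real \<Rightarrow> ennreal"
  assumes [measurable]: "h \<in> borel_measurable borel" and even: "\<And>x. h \<bar>x\<bar> = h x"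
  shows "(\<integral>\<^sup>+x. h x \<partial>lborel) = 2 * (\<integral>\<^sup>+x. h x * indicator {0..} x \<partial>lborel)"
proof -
  have m: "h (- x) = h x" for x using even[of x] even[of "- x"] by simp
  \<comment> \<open>At 0 both indicators equal 1, but this point is null.\<close>
  have "(\<integral>\<^sup>+x. h x \<partial>lborel) = (\<integral>\<^sup>+x. h x * indicator {0..} x + h x * indicator {..0} x \<partial>lborel)"
    by (rule nn_integral_cong_AE, use AE_lborel_singleton[of 0] in eventually_elim)
      (auto split: split_indicator)
  also have "\<dots> = (\<integral>\<^sup>+x. h x * indicator {0..} x \<partial>lborel) + (\<integral>\<^sup>+x. h x * indicator {..0} x \<partial>lborel)"
    by (rule nn_integral_add) measurable
  also have "(\<integral>\<^sup>+x. h x * indicator {..0} x \<partial>lborel) = (\<integral>\<^sup>+x. h x * indicator {0..} x \<partial>lborel)"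
    by (subst lborel_distr_uminus[symmetric], subst nn_integral_distr)
      (auto intro!: nn_integral_cong simp: m split: split_indicator)
  finally show ?thesis by (simp add: mult_2)
qed

text \<open>Each induction step folds one more coordinate onto the half-line and contributes a
  factor 2.\<close>

lemma nn_integral_PiM_even:
  fixes H :: "('i \<Rightarrow> real) \<Rightarrow> ennreal"
  assumes "finite I"
    and "H \<in> borel_measurable (PiM I (\<lambda>_. lborel))"
    and "\<And>x. x \<in> extensional I \<Longrightarrow> H (\<lambda>i\<in>I. \<bar>x i\<bar>) = H x"
  shows "(\<integral>\<^sup>+x. H x \<partial>PiM I (\<lambda>_. lborel))
    = 2 ^ card I * (\<integral>\<^sup>+x. H x * indicator (nonneg_coords I) x \<partial>PiM I (\<lambda>_. lborel))"
  using assms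
proof (induction I arbitrary: H rule: finite_induct)
  case empty
  then show ?case by simp
next
  case (insert i I)
  note [measurable] = insert.prems(1)
  note [simp] = insert.hyps
  note even = insert.prems(2)
  interpret product_sigma_finite "\<lambda>_::'i. lborel :: real measure" ..
  interpret finite_product_sigma_finite "\<lambda>_::'i. lborel :: real measure" I by standard simp
  let ?J = "\<lambda>a. \<integral>\<^sup>+x. H (x(i := a)) * indicator (nonneg_coords I) x \<partial>PiM I (\<lambda>_. lborel)"
  note [measurable] = measurable_fun_upd_swapped[of i I]
  have meas: "?J \<in> borel_measurable borel"
    by measurable
  \<comment> \<open>The assumption folds all coordinates at once. Points with the same
    coordinatewise absolute values therefore have the same value, which allows folding coordinate
    \<open>i\<close> alone or the others alone.\<close>
  have H_abs: "H (x(i := \<bar>a\<bar>)) = H (x(i := a))" "H ((\<lambda>j\<in>I. \<bar>x j\<bar>)(i := a)) = H (x(i := a))"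
    if "x \<in> extensional I" for x a
  proof -
    have upd: "(\<lambda>j\<in>insert i I. \<bar>(x(i := a)) j\<bar>) = (\<lambda>j\<in>I. \<bar>x j\<bar>)(i := \<bar>a\<bar>)" for x :: "'i \<Rightarrow> real" and a
      by (auto simp: fun_eq_iff)
    have E: "H ((\<lambda>j\<in>I. \<bar>x j\<bar>)(i := \<bar>a\<bar>)) = H (x(i := a))" if "x \<in> extensional I" for x a
    proof -
      have "x(i := a) \<in> extensional (insert i I)" using that by (simp add: extensional_def)
      from even[OF this] show ?thesis by (simp only: upd)
    qed
    show "H (x(i := \<bar>a\<bar>)) = H (x(i := a))"
      using E[OF that, of a] E[OF that, of "\<bar>a\<bar>"] by simp
    show "H ((\<lambda>j\<in>I. \<bar>x j\<bar>)(i := a)) = H (x(i := a))"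
      using E[OF that, of a] E[of "\<lambda>j\<in>I. \<bar>x j\<bar>" a] by (simp cong: restrict_cong)
  qed
  have "(\<integral>\<^sup>+x. H x \<partial>PiM (insert i I) (\<lambda>_. lborel)) = (\<integral>\<^sup>+a. \<integral>\<^sup>+x. H (x(i := a)) \<partial>PiM I (\<lambda>_. lborel) \<partial>lborel)"
    by (rule product_nn_integral_insert_rev) auto
  also have "\<dots> = (\<integral>\<^sup>+a. 2 ^ card I * ?J a \<partial>lborel)"
  proof (intro nn_integral_cong insert.IH)
    show "(\<lambda>x. H (x(i := a))) \<in> borel_measurable (PiM I (\<lambda>_. lborel))" for a
      by measurable
  qed (rule H_abs)
  also have "\<dots> = 2 ^ card I * (\<integral>\<^sup>+a. ?J a \<partial>lborel)"
    using meas by (intro nn_integral_cmult) auto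
  also have "(\<integral>\<^sup>+a. ?J a \<partial>lborel) = 2 * (\<integral>\<^sup>+a. ?J a * indicator {0..} a \<partial>lborel)"
    using meas by (intro nn_integral_even_real nn_integral_cong) (auto simp: space_PiM PiE_def H_abs)
  also have "(\<integral>\<^sup>+a. ?J a * indicator {0..} a \<partial>lborel)
      = (\<integral>\<^sup>+x. H x * indicator (nonneg_coords (insert i I)) x \<partial>PiM (insert i I) (\<lambda>_. lborel))"
    by (rule nn_integral_PiM_insert_nonneg[symmetric]) auto
  finally show ?case by (simp add: mult_ac)
qed

section \<open>Transfer from product measures to Euclidean spaces\<close>

definition nonneg_orthant :: "'a::euclidean_space set" where
  "nonneg_orthant = {x. \<forall>b\<in>Basis. 0 \<le> x \<bullet> b}"

lemma nonneg_orthant_borel [measurable]: "nonneg_orthant \<in> sets borel"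
  unfolding nonneg_orthant_def by measurable

lemma nn_integral_lborel_PiM:
  fixes F :: "'a::euclidean_space \<Rightarrow> ennreal"
  assumes [measurable]: "F \<in> borel_measurable borel"
  shows "(\<integral>\<^sup>+x. F x \<partial>lborel) = (\<integral>\<^sup>+x. F (\<Sum>b\<in>Basis. x b *\<^sub>R b) \<partial>PiM Basis (\<lambda>_. lborel))"
  by (subst lborel_eq, subst nn_integral_distr) auto

lemma nn_integral_nonneg_orthant_PiM:
  fixes F :: "'a::euclidean_space \<Rightarrow> ennreal"
  assumes [measurable]: "F \<in> borel_measurable borel"
  shows "(\<integral>\<^sup>+x. F x * indicator nonneg_orthant x \<partial>lborel)
    = (\<integral>\<^sup>+x. F (\<Sum>b\<in>Basis. x b *\<^sub>R b) * indicator (nonneg_coords Basis) x \<partial>PiM Basis (\<lambda>_. lborel))"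
  by (subst nn_integral_lborel_PiM)
    (auto intro!: nn_integral_cong simp: nonneg_orthant_def split: split_indicator)

lemma prekopa_leindler_nonneg_orthant:
  fixes F G H :: "'a::euclidean_space \<Rightarrow> ennreal"
  assumes [measurable]: "F \<in> borel_measurable borel" "G \<in> borel_measurable borel" "H \<in> borel_measurable borel"
    and le: "\<And>x y. x \<in> nonneg_orthant \<Longrightarrow> y \<in> nonneg_orthant
      \<Longrightarrow> F x * G y \<le> (H (\<Sum>b\<in>Basis. sqrt ((x \<bullet> b) * (y \<bullet> b)) *\<^sub>R b))\<^sup>2"
  shows "(\<integral>\<^sup>+x. F x * indicator nonneg_orthant x \<partial>lborel) * (\<integral>\<^sup>+x. G x * indicator nonneg_orthant x \<partial>lborel)
    \<le> (\<integral>\<^sup>+x. H x * indicator nonneg_orthant x \<partial>lborel)\<^sup>2"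
proof -
  have "F (\<Sum>b\<in>Basis. x b *\<^sub>R b) * G (\<Sum>b\<in>Basis. y b *\<^sub>R b)
      \<le> (H (\<Sum>b\<in>Basis. (\<lambda>b\<in>Basis. sqrt (x b * y b)) b *\<^sub>R b))\<^sup>2"
    if "x \<in> nonneg_coords Basis" "y \<in> nonneg_coords Basis" for x y
    using le[of "\<Sum>b\<in>Basis. x b *\<^sub>R b" "\<Sum>b\<in>Basis. y b *\<^sub>R b"] that
    by (simp add: nonneg_orthant_def cong: sum.cong)
  then show ?thesis
    by (subst (1 2 3) nn_integral_nonneg_orthant_PiM)
      (auto intro!: prekopa_leindler_PiM_nonneg)
qed

lemma nn_integral_even_orthant:
  fixes H :: "'a::euclidean_space \<Rightarrow> ennreal"
  assumes [measurable]: "H \<in> borel_measurable borel"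
    and even: "\<And>x. H (\<Sum>b\<in>Basis. \<bar>x \<bullet> b\<bar> *\<^sub>R b) = H x"
  shows "(\<integral>\<^sup>+x. H x \<partial>lborel) = 2 ^ DIM('a) * (\<integral>\<^sup>+x. H x * indicator nonneg_orthant x \<partial>lborel)"
proof -
  have "H (\<Sum>b\<in>Basis. (\<lambda>b\<in>Basis. \<bar>x b\<bar>) b *\<^sub>R b) = H (\<Sum>b\<in>Basis. x b *\<^sub>R b)" for x
    using even[of "\<Sum>b\<in>Basis. x b *\<^sub>R b"] by (simp cong: sum.cong)
  then show ?thesis
    by (subst nn_integral_nonneg_orthant_PiM nn_integral_lborel_PiM, simp)+
      (auto intro!: nn_integral_PiM_even)
qed

section \<open>Linear changes of variables\<close>

text \<open>The change of variables formula of the library is stated for \<open>real ^ 'n\<close> with a well-ordered index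
  type, so a type of cardinality \<open>DIM('a)\<close> is needed to carry it over to a Euclidean space \<open>'a\<close>.\<close>
typedef (overloaded) 'a::euclidean_space basis_index = "{..<DIM('a)}"
  using DIM_positive by blast

setup_lifting type_definition_basis_index

instantiation basis_index :: (euclidean_space) wellorder
begin

lift_definition less_eq_basis_index :: "'a basis_index \<Rightarrow> 'a basis_index \<Rightarrow> bool" is "(\<le>)" .
lift_definition less_basis_index :: "'a basis_index \<Rightarrow> 'a basis_index \<Rightarrow> bool" is "(<)" .

instance
proof
  fix P :: "'a basis_index \<Rightarrow> bool" and a
  assume step: "\<And>x. (\<And>y. y < x \<Longrightarrow> P y) \<Longrightarrow> P x"
  show "P a"
    by (induction a rule: measure_induct_rule[of Rep_basis_index])
      (auto intro: step simp: less_basis_index.rep_eq)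
qed (transfer; auto)+

end

lemma bij_betw_Rep_basis_index:
  "bij_betw (Rep_basis_index :: 'a::euclidean_space basis_index \<Rightarrow> nat) UNIV {..<DIM('a)}"
  using type_definition.Rep_range[OF type_definition_basis_index]
  by (simp add: bij_betw_def inj_def Rep_basis_index_inject)

instance basis_index :: (euclidean_space) finite
  by standard (metis bij_betw_Rep_basis_index bij_betw_finite finite_lessThan)

lemma borel_measurable_linear_euclidean:
  fixes f :: "'b::euclidean_space \<Rightarrow> 'c::euclidean_space"
  assumes "linear f"
  shows "f \<in> borel_measurable borel"
  using assms
  by (intro borel_measurable_continuous_onI linear_continuous_on) (simp add: linear_conv_bounded_linear)

text \<open>Boundedness gives \<open>S\<close> finite Lebesgue measure, so the determinant formula
  for \<open>measure lebesgue\<close> applies; the Borel assumptions bring it back to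
  \<open>lborel\<close>.\<close>

lemma emeasure_lborel_linear_image:
  fixes f :: "real^'n::{finite,wellorder} \<Rightarrow> real^'n::_"
  assumes "linear f" and "f ` S \<in> sets borel" "S \<in> sets borel" "bounded S"
  shows "emeasure lborel (f ` S) = ennreal \<bar>det (matrix f)\<bar> * emeasure lborel S"
proof -
  have S: "S \<in> lmeasurable"
    using assms by (simp add: bounded_set_imp_lmeasurable)
  have "emeasure lborel (f ` S) = ennreal (measure lebesgue (f ` S))"
    using emeasure_eq_measure2[OF measurable_linear_image[OF assms(1) S]] assms
    by (simp del: measure_completion)
  also have "\<dots> = ennreal \<bar>det (matrix f)\<bar> * emeasure lebesgue S"
    by (simp add: measure_linear_image[OF assms(1) S] ennreal_mult emeasure_eq_measure2 S)
  finally show ?thesis using assms by simp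
qed

text \<open>Lebesgue measure is determined by its values on boxes. The preimage of a box is its
  image under the inverse, scaled by the reciprocal determinant, which the density
  compensates.\<close>

lemma lborel_distr_linear:
  fixes f :: "real^'n::{finite,wellorder} \<Rightarrow> real^'n::_"
  assumes "linear f" "bij f"
  shows "lborel = density (distr lborel borel f) (\<lambda>_. ennreal \<bar>det (matrix f)\<bar>)"
proof (rule lborel_eqI)
  have lin_inv: "linear (inv f)"
    using assms by (intro inj_linear_imp_inv_linear) (auto simp: bij_is_inj)
  have [measurable]: "f \<in> borel_measurable borel"
    using assms(1) by (rule borel_measurable_linear_euclidean)
  have "matrix f ** matrix (inv f) = matrix (f \<circ> inv f)"
    using assms lin_inv by (simp add: matrix_compose)
  also have "f \<circ> inv f = id" using assms by (simp add: bij_is_surj flip: surj_iff)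
  finally have det: "\<bar>det (matrix f)\<bar> * \<bar>det (matrix (inv f))\<bar> = 1"
    by (simp add: matrix_id flip: abs_mult det_mul)
  fix l u :: "real^'n::_"
  assume lu: "\<And>b. b \<in> Basis \<Longrightarrow> l \<bullet> b \<le> u \<bullet> b"
  have img: "f -` box l u = inv f ` box l u"
    using assms by (simp add: bij_vimage_eq_inv_image)
  have "f -` box l u \<in> sets borel" by (rule measurable_sets_borel[of _ borel]) auto
  then have "emeasure lborel (f -` box l u) = ennreal \<bar>det (matrix (inv f))\<bar> * emeasure lborel (box l u)"
    unfolding img using lin_inv by (intro emeasure_lborel_linear_image) auto
  then show "emeasure (density (distr lborel borel f) (\<lambda>_. ennreal \<bar>det (matrix f)\<bar>)) (box l u)
      = ennreal (\<Prod>b\<in>Basis. (u - l) \<bullet> b)"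
    using lu det by (simp add: emeasure_density nn_integral_cmult emeasure_distr
        emeasure_lborel_box flip: ennreal_mult mult.assoc)
qed simp

lemma nn_integral_lborel_linear:
  fixes f :: "real^'n::{finite,wellorder} \<Rightarrow> real^'n::_" and F :: "real^'n::_ \<Rightarrow> ennreal"
  assumes "linear f" "bij f" and [measurable]: "F \<in> borel_measurable borel"
  shows "(\<integral>\<^sup>+x. F x \<partial>lborel) = ennreal \<bar>det (matrix f)\<bar> * (\<integral>\<^sup>+x. F (f x) \<partial>lborel)"
proof -
  have [measurable]: "f \<in> borel_measurable borel"
    using assms(1) by (rule borel_measurable_linear_euclidean)
  show ?thesis
    by (subst lborel_distr_linear[OF assms(1,2)])
      (simp add: nn_integral_density nn_integral_distr nn_integral_cmult)
qed

text \<open>Coordinates with respect to an enumeration \<open>e\<close> of the orthonormal basis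
  preserve inner products and match boxes with boxes of the same volume, hence preserve Lebesgue
  measure.\<close>

lemma isometry_basis_index:
  obtains \<phi> :: "real^('a::euclidean_space basis_index) \<Rightarrow> 'a"
  where "linear \<phi>" "bij \<phi>" "\<And>x y. \<phi> x \<bullet> \<phi> y = x \<bullet> y"
    "\<And>F::'a \<Rightarrow> ennreal. F \<in> borel_measurable borel \<Longrightarrow> (\<integral>\<^sup>+x. F x \<partial>lborel) = (\<integral>\<^sup>+x. F (\<phi> x) \<partial>lborel)"
proof -
  obtain e where e: "bij_betw e (UNIV :: 'a basis_index set) (Basis :: 'a set)"
    using bij_betw_Rep_basis_index
    by (metis bij_betw_iff_card bij_betw_same_card card_lessThan finite_Basis finite_lessThan finite_class.finite_UNIV)
  define \<phi> where "\<phi> x = (\<Sum>i\<in>UNIV. x $ i *\<^sub>R e i)" for x :: "real^'a basis_index"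
  define \<psi> where "\<psi> y = (\<chi> i. y \<bullet> e i)" for y :: 'a
  have e_inner: "e i \<bullet> e j = (if i = j then 1 else 0)" for i j
    using e by (metis UNIV_I bij_betwE bij_betw_inv_into_left inner_Basis)
  have lin: "linear \<phi>"
    unfolding \<phi>_def by (intro linear_compose_sum ballI linear_compose_scale_right) (auto intro!: linearI simp: algebra_simps)
  have \<psi>\<phi>: "\<psi> (\<phi> x) = x" for x
    by (simp add: \<phi>_def \<psi>_def vec_eq_iff inner_sum_left e_inner if_distrib cong: if_cong)
  have \<phi>\<psi>: "\<phi> (\<psi> y) = y" for y
    unfolding \<phi>_def \<psi>_def using sum.reindex_bij_betw[OF e, of "\<lambda>b. (y \<bullet> b) *\<^sub>R b"]
    by (simp add: euclidean_representation)
  have bij: "bij \<phi>"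
    by (rule o_bij[of \<psi>]) (auto simp: fun_eq_iff \<psi>\<phi> \<phi>\<psi>)
  have inner: "\<phi> x \<bullet> \<phi> y = x \<bullet> y" for x y
    by (simp add: \<phi>_def inner_sum_left inner_sum_right e_inner inner_vec_def if_distrib mult.commute cong: if_cong)
  have [measurable]: "\<phi> \<in> borel_measurable borel"
    using lin by (rule borel_measurable_linear_euclidean)
  have "(lborel :: 'a measure) = distr lborel borel \<phi>"
  proof (rule lborel_eqI)
    fix l u :: 'a
    assume lu: "\<And>b. b \<in> Basis \<Longrightarrow> l \<bullet> b \<le> u \<bullet> b"
    have img: "\<phi> -` box l u = box (\<psi> l) (\<psi> u)"
    proof -
      have "\<phi> x \<bullet> e i = x $ i" for x i using \<psi>\<phi>[of x] by (simp add: \<psi>_def vec_eq_iff)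
      moreover have "(\<forall>b\<in>Basis. P b) \<longleftrightarrow> (\<forall>i. P (e i))" for P :: "'a \<Rightarrow> bool"
        using e by (metis UNIV_I bij_betwE bij_betw_iff_bijections)
      ultimately show ?thesis
        by (simp add: set_eq_iff mem_box(1)[where 'a='a] mem_box_cart \<psi>_def)
    qed
    have lu': "l \<bullet> e i \<le> u \<bullet> e i" for i using lu e by (auto dest: bij_betwE)
    have "emeasure (distr lborel borel \<phi>) (box l u) = emeasure lborel (box (\<psi> l) (\<psi> u))"
      by (simp add: emeasure_distr img)
    also have "\<dots> = ennreal (\<Prod>d\<in>Basis. (\<psi> u - \<psi> l) \<bullet> d)"
      using lu' by (intro emeasure_lborel_box) (auto simp: Basis_vec_def inner_axis \<psi>_def)
    also have "(\<Prod>d\<in>Basis. (\<psi> u - \<psi> l) \<bullet> d) = (\<Prod>i\<in>UNIV. (\<psi> u - \<psi> l) \<bullet> axis i 1)"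
      by (rule prod.reindex_bij_betw[symmetric]) (auto simp: bij_betw_def inj_def axis_eq_axis Basis_vec_def)
    also have "\<dots> = (\<Prod>i\<in>UNIV. (u - l) \<bullet> e i)"
      by (simp add: inner_axis \<psi>_def inner_diff_left)
    also have "(\<Prod>i\<in>UNIV. (u - l) \<bullet> e i) = (\<Prod>b\<in>Basis. (u - l) \<bullet> b)"
      by (rule prod.reindex_bij_betw[OF e])
    finally show "emeasure (distr lborel borel \<phi>) (box l u) = ennreal (\<Prod>b\<in>Basis. (u - l) \<bullet> b)" .
  qed simp
  then have "(\<integral>\<^sup>+x. F x \<partial>lborel) = (\<integral>\<^sup>+x. F (\<phi> x) \<partial>lborel)"
    if [measurable]: "F \<in> borel_measurable borel" for F :: "'a \<Rightarrow> ennreal"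
    by (subst \<open>lborel = distr lborel borel \<phi>\<close>, subst nn_integral_distr) auto
  with that lin bij inner show ?thesis by blast
qed

text \<open>\<open>k\<close> is the absolute determinant of \<open>T\<close>, read off from matrices
  after conjugation with the isometry \<open>\<phi>\<close>. Duality makes the transpose of the
  matrix of \<open>s\<close> inverse to that of \<open>t\<close>, so the determinants are
  reciprocal; only this is needed later, hence the anonymous \<open>k\<close>.\<close>

lemma nn_integral_linear_contragredient:
  fixes T S :: "'a::euclidean_space \<Rightarrow> 'a"
  assumes T: "linear T" "bij T" and S: "linear S" "bij S"
    and dual: "\<And>x y. T x \<bullet> S y = x \<bullet> y"
  obtains k :: real where "k > 0"
    "\<And>F. F \<in> borel_measurable borel \<Longrightarrow> (\<integral>\<^sup>+x. F x \<partial>lborel) = ennreal k * (\<integral>\<^sup>+x. F (T x) \<partial>lborel)"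
    "\<And>G. G \<in> borel_measurable borel \<Longrightarrow> (\<integral>\<^sup>+x. G x \<partial>lborel) = ennreal (1 / k) * (\<integral>\<^sup>+x. G (S x) \<partial>lborel)"
proof -
  obtain \<phi> :: "real^('a basis_index) \<Rightarrow> 'a"
    where \<phi>: "linear \<phi>" "bij \<phi>" and inner: "\<And>x y. \<phi> x \<bullet> \<phi> y = x \<bullet> y"
      and int: "\<And>F::'a \<Rightarrow> ennreal. F \<in> borel_measurable borel \<Longrightarrow> (\<integral>\<^sup>+x. F x \<partial>lborel) = (\<integral>\<^sup>+x. F (\<phi> x) \<partial>lborel)"
    using isometry_basis_index by blast
  define t where "t = inv \<phi> \<circ> T \<circ> \<phi>"
  define s where "s = inv \<phi> \<circ> S \<circ> \<phi>"
  have \<phi>_inv: "\<phi> (inv \<phi> x) = x" for x using \<phi> by (simp add: bij_is_surj surj_f_inv_f)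
  have inv_\<phi>: "inv \<phi> (\<phi> x) = x" for x using \<phi> by (simp add: bij_is_inj)
  have lin_inv: "linear (inv \<phi>)"
  proof (rule linearI)
    fix x y :: 'a and r :: real
    have "\<phi> (inv \<phi> x + inv \<phi> y) = x + y" "\<phi> (r *\<^sub>R inv \<phi> x) = r *\<^sub>R x"
      using \<phi> by (simp_all add: linear_add linear_cmul \<phi>_inv)
    then show "inv \<phi> (x + y) = inv \<phi> x + inv \<phi> y" "inv \<phi> (r *\<^sub>R x) = r *\<^sub>R inv \<phi> x"
      by (metis inv_\<phi>)+
  qed
  have t: "linear t" "bij t" and s: "linear s" "bij s"
    unfolding t_def s_def using \<phi> T S lin_inv by (auto intro!: linear_compose bij_comp bij_imp_bij_inv)
  have \<phi>t: "\<phi> (t x) = T (\<phi> x)" and \<phi>s: "\<phi> (s x) = S (\<phi> x)" for x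
    by (simp_all add: t_def s_def \<phi>_inv)
  have ts: "t x \<bullet> s y = x \<bullet> y" for x y
    by (simp add: dual \<phi>t \<phi>s flip: inner)
  \<comment> \<open>A matrix that leaves every scalar product \<open>x \<bullet> y\<close> unchanged
    when applied to \<open>y\<close> is the identity.\<close>
  have "transpose (matrix s) ** matrix t = mat 1"
  proof -
    have "x \<bullet> ((transpose (matrix s) ** matrix t) *v y) = x \<bullet> y" for x y
    proof -
      have "x \<bullet> ((transpose (matrix s) ** matrix t) *v y) = ((matrix t *v y) v* matrix s) \<bullet> x"
        by (simp add: inner_commute del: matrix_vector_mul_assoc flip: matrix_vector_mul_assoc)
      also have "\<dots> = t y \<bullet> s x"
        unfolding dot_lmul_matrix using t s by (simp add: matrix_works)
      also have "\<dots> = x \<bullet> y"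
        unfolding ts by (rule inner_commute)
      finally show ?thesis .
    qed
    then have "(transpose (matrix s) ** matrix t) *v y = mat 1 *v y" for y
      unfolding matrix_vector_mul_lid by (metis vector_eq_ldot)
    then show ?thesis by (simp add: matrix_eq)
  qed
  then have "det (matrix s) * det (matrix t) = 1"
    by (metis det_I det_mul det_transpose)
  then have det: "\<bar>det (matrix s)\<bar> * \<bar>det (matrix t)\<bar> = 1"
    by (simp flip: abs_mult)
  then have det_ne: "det (matrix t) \<noteq> 0" by auto
  have det_s: "1 / \<bar>det (matrix t)\<bar> = \<bar>det (matrix s)\<bar>"
    using det det_ne by (simp add: divide_eq_eq)
  note [measurable] = \<phi>(1)[THEN borel_measurable_linear_euclidean]
    T(1)[THEN borel_measurable_linear_euclidean] S(1)[THEN borel_measurable_linear_euclidean]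
  have "(\<integral>\<^sup>+x. F x \<partial>lborel) = ennreal \<bar>det (matrix t)\<bar> * (\<integral>\<^sup>+x. F (T x) \<partial>lborel)"
    if [measurable]: "F \<in> borel_measurable borel" for F :: "'a \<Rightarrow> ennreal"
    using nn_integral_lborel_linear[OF t, of "\<lambda>x. F (\<phi> x)"] int[of F] int[of "\<lambda>x. F (T x)"]
    by (simp add: \<phi>t)
  moreover have "(\<integral>\<^sup>+x. F x \<partial>lborel) = ennreal (1 / \<bar>det (matrix t)\<bar>) * (\<integral>\<^sup>+x. F (S x) \<partial>lborel)"
    if [measurable]: "F \<in> borel_measurable borel" for F :: "'a \<Rightarrow> ennreal"
    using nn_integral_lborel_linear[OF s, of "\<lambda>x. F (\<phi> x)"] int[of F] int[of "\<lambda>x. F (S x)"]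
    by (simp add: \<phi>s det_s)
  moreover have "0 < \<bar>det (matrix t)\<bar>" using det_ne by simp
  ultimately show ?thesis using that by meson
qed

section \<open>Structure of Yao-Yao partitions\<close>

text \<open>For independent \<open>B\<close> this is a simplicial cone with apex \<open>c\<close>,
  the shape of every Yao-Yao cell.\<close>

definition cone_at :: "'a::real_vector \<Rightarrow> 'a set \<Rightarrow> 'a set" where
  "cone_at c B = {c + (\<Sum>b\<in>B. u b *\<^sub>R b) | u. \<forall>b\<in>B. 0 \<le> u b}"

text \<open>Since \<open>w\<close> is not in \<open>B\<close>, its coefficient is free and serves as
  the parameter along the added ray.\<close>

lemma cone_at_insert_ray:
  assumes "finite B" "w \<notin> B"
  shows "pos_ray_sum (cone_at c B) w = cone_at c (insert w B)"
proof (intro set_eqI iffI)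
  fix x assume "x \<in> pos_ray_sum (cone_at c B) w"
  then obtain u t where *: "x = c + (\<Sum>b\<in>B. u b *\<^sub>R b) + t *\<^sub>R w" "\<forall>b\<in>B. 0 \<le> u b" "t \<ge> 0"
    unfolding pos_ray_sum_def cone_at_def by auto
  have "(\<Sum>b\<in>B. (u(w := t)) b *\<^sub>R b) = (\<Sum>b\<in>B. u b *\<^sub>R b)"
    using assms by (intro sum.cong) auto
  then have "x = c + (\<Sum>b\<in>insert w B. (u(w := t)) b *\<^sub>R b)"
    using * assms by (simp add: algebra_simps)
  moreover have "\<forall>b\<in>insert w B. 0 \<le> (u(w := t)) b" using * by auto
  ultimately show "x \<in> cone_at c (insert w B)" unfolding cone_at_def by blast
next
  fix x assume "x \<in> cone_at c (insert w B)"
  then obtain u where *: "x = c + (\<Sum>b\<in>insert w B. u b *\<^sub>R b)" "\<forall>b\<in>insert w B. 0 \<le> u b"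
    unfolding cone_at_def by auto
  then have "x = (c + (\<Sum>b\<in>B. u b *\<^sub>R b)) + u w *\<^sub>R w" using assms by (simp add: algebra_simps)
  then show "x \<in> pos_ray_sum (cone_at c B) w"
    unfolding pos_ray_sum_def cone_at_def using *(2)
    by (intro CollectI exI[of _ "c + (\<Sum>b\<in>B. u b *\<^sub>R b)"] exI[of _ "u w"]) auto
qed

text \<open>Makes both halves of a construction step instances of adding one generator,
  \<open>v\<close> or \<open>- v\<close>.\<close>

lemma neg_ray_sum_eq_pos: "neg_ray_sum A v = pos_ray_sum A (- v)"
  unfolding neg_ray_sum_def pos_ray_sum_def
proof (intro set_eqI iffI; clarify)
  fix a t assume "a \<in> A"
  show "\<exists>a' t'. a + t *\<^sub>R v = a' + t' *\<^sub>R (- v) \<and> a' \<in> A \<and> 0 \<le> t'" if "t \<le> 0"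
    using \<open>a \<in> A\<close> that by (intro exI[of _ a] exI[of _ "- t"]) simp
  show "\<exists>a' t'. a + t *\<^sub>R (- v) = a' + t' *\<^sub>R v \<and> a' \<in> A \<and> t' \<le> 0" if "0 \<le> t"
    using \<open>a \<in> A\<close> that by (intro exI[of _ a] exI[of _ "- t"]) simp
qed

text \<open>This is the direction space of \<open>F\<close>; being a subspace, it contains the span
  of generators taken from it.\<close>

lemma translates_subspace:
  assumes "affine F" "c \<in> F"
  shows "subspace {x. c + x \<in> F}"
proof (rule subspaceI)
  fix x y and r :: real
  assume x: "x \<in> {x. c + x \<in> F}"
  have "(1 - r) *\<^sub>R c + r *\<^sub>R (c + x) \<in> F"
    using assms x by (intro mem_affine) auto
  then show "r *\<^sub>R x \<in> {x. c + x \<in> F}" by (simp add: algebra_simps)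
  assume "y \<in> {x. c + x \<in> F}"
  with assms x have "(1::real) *\<^sub>R (c + x) + 1 *\<^sub>R (c + y) + (-1) *\<^sub>R c \<in> F"
    by (intro mem_affine_3) auto
  then show "x + y \<in> {x. c + x \<in> F}" by (simp add: algebra_simps)
qed (use assms in simp)

text \<open>Induction along the construction: each step adds a generator outside the span of the
  previous ones, since that span lies in the direction space of \<open>F\<close>. The clause on
  \<open>c + b\<close> carries this information. The number of cells is only bounded above, so no
  distinctness of cells has to be proved.\<close>

lemma yao_yao_structure:
  fixes E :: "'a::euclidean_space set"
  assumes "yao_yao E P c"
  shows "affine E \<and> c \<in> E \<and> finite P \<and> card P \<le> 2 ^ nat (aff_dim E)
    \<and> (\<forall>A\<in>P. \<exists>B. finite B \<and> independent B \<and> int (card B) = aff_dim E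
          \<and> (\<forall>b\<in>B. c + b \<in> E) \<and> A = cone_at c B)"
  using assms
proof induction
  case (base c)
  then show ?case by (auto simp: cone_at_def independent_empty intro!: exI[of _ "{}"])
next
  case (step E F a v Pm c Pp)
  have dims: "nat (aff_dim E) = Suc (nat (aff_dim F))"
    using step by auto
  have cE: "c \<in> E" and cF: "c \<in> F" using step by auto
  \<comment> \<open>The construction states the position of \<open>v\<close> relative to
    \<open>F\<close> at the point \<open>a\<close>; affine combinations move it to the apex
    \<open>c\<close>.\<close>
  have cv: "c + v \<in> E" "c + v \<notin> F"
  proof -
    have "a \<in> E" using step by auto
    then have "(1::real) *\<^sub>R c + 1 *\<^sub>R (a + v) + (-1) *\<^sub>R a \<in> E"
      by (intro mem_affine_3) (use step cE in auto)
    then show "c + v \<in> E" by simp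
    show "c + v \<notin> F"
    proof
      assume "c + v \<in> F"
      then have "(1::real) *\<^sub>R a + 1 *\<^sub>R (c + v) + (-1) *\<^sub>R c \<in> F"
        by (intro mem_affine_3) (use step cF in auto)
      then show False using step by (simp add: algebra_simps)
    qed
  qed
  have cell: "\<exists>B'. finite B' \<and> independent B' \<and> int (card B') = aff_dim E
          \<and> (\<forall>b\<in>B'. c + b \<in> E) \<and> pos_ray_sum A w = cone_at c B'"
    if A: "finite B" "independent B" "int (card B) = aff_dim F" "\<forall>b\<in>B. c + b \<in> F" "A = cone_at c B"
      and w: "w = v \<or> w = - v" for A B w
  proof -
    have subF: "subspace {x. c + x \<in> F}" and subE: "subspace {x. c + x \<in> E}"
      using step cF cE by (auto intro: translates_subspace)
    have "span B \<subseteq> {x. c + x \<in> F}" using A subF by (intro span_minimal) auto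
    then have "v \<notin> span B" using cv by auto
    then have w_span: "w \<notin> span B" using w span_neg[of w B] by auto
    then have "w \<notin> B" using span_base by blast
    moreover have "c + w \<in> E" using w cv subspace_neg[OF subE, of v] by auto
    moreover have "int (card (insert w B)) = aff_dim E"
      using A(1,3) \<open>w \<notin> B\<close> step.hyps(5) by simp
    moreover have "\<forall>b\<in>B. c + b \<in> E" using A(4) step.hyps(4) by blast
    ultimately show ?thesis
      using A(1,2,5) w_span
      by (intro exI[of _ "insert w B"]) (simp add: cone_at_insert_ray independent_insert)
  qed
  let ?P = "(\<lambda>A. neg_ray_sum A v) ` Pm \<union> (\<lambda>A. pos_ray_sum A v) ` Pp"
  have "card ?P \<le> card Pm + card Pp"
    using step by (meson card_Un_le card_image_le add_mono order_trans)
  also have "\<dots> \<le> 2 ^ nat (aff_dim F) + 2 ^ nat (aff_dim F)"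
    using step.IH by (intro add_mono) blast+
  finally have "card ?P \<le> 2 ^ nat (aff_dim E)" by (simp add: dims)
  moreover have "\<exists>B. finite B \<and> independent B \<and> int (card B) = aff_dim E
          \<and> (\<forall>b\<in>B. c + b \<in> E) \<and> A = cone_at c B" if "A \<in> ?P" for A
  proof -
    from that have "\<exists>A'\<in>Pm \<union> Pp. \<exists>w. A = pos_ray_sum A' w \<and> (w = v \<or> w = - v)"
      unfolding neg_ray_sum_eq_pos by blast
    then obtain A' w where *: "A = pos_ray_sum A' w" "w = v \<or> w = - v" "A' \<in> Pm \<union> Pp"
      by blast
    then obtain B where "finite B" "independent B" "int (card B) = aff_dim F" "\<forall>b\<in>B. c + b \<in> F" "A' = cone_at c B"
      using step.IH by (elim UnE) meson+
    from cell[OF this *(2)] show ?thesis by (simp add: *(1))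
  qed
  moreover have "finite ?P" using step.IH by simp
  ultimately show ?case using step.hyps(1) cE by (intro conjI ballI)
qed

text \<open>The dual cones of the cells cover the space: at each step of the construction, choose the side of
  the hyperplane according to the sign of \<open>v \<bullet> y\<close>.\<close>
lemma yao_yao_dual_cover:
  assumes "yao_yao E P c"
  shows "\<exists>A\<in>P. \<forall>x\<in>A. 0 \<le> (x - c) \<bullet> y"
  using assms
proof induction
  case (base c)
  then show ?case by simp
next
  case (step E F a v Pm c Pp)
  then obtain Am Ap where Am: "Am \<in> Pm" "\<forall>x\<in>Am. 0 \<le> (x - c) \<bullet> y"
    and Ap: "Ap \<in> Pp" "\<forall>x\<in>Ap. 0 \<le> (x - c) \<bullet> y" by blast
  have shift: "(x + t *\<^sub>R v - c) \<bullet> y = (x - c) \<bullet> y + t * (v \<bullet> y)" for x t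
    by (simp add: algebra_simps)
  show ?case
  proof (cases "v \<bullet> y \<ge> 0")
    case True
    then have "\<forall>x\<in>pos_ray_sum Ap v. 0 \<le> (x - c) \<bullet> y"
      using Ap by (auto simp: pos_ray_sum_def shift)
    then show ?thesis using Ap(1) by blast
  next
    case False
    then have "\<forall>x\<in>neg_ray_sum Am v. 0 \<le> (x - c) \<bullet> y"
      using Am by (auto simp: neg_ray_sum_def shift mult_nonpos_nonpos)
    then show ?thesis using Am(1) by blast
  qed
qed

section \<open>The Santalo inequality\<close>

lemma bij_linear_image_borel:
  fixes T :: "'a::euclidean_space \<Rightarrow> 'a"
  assumes "linear T" "bij T" and [measurable]: "X \<in> sets borel"
  shows "(\<lambda>x. c + T x) ` X \<in> sets borel"
proof -
  have "linear (inv T)" using assms by (intro inj_linear_imp_inv_linear) (auto simp: bij_is_inj)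
  note [measurable] = borel_measurable_linear_euclidean[OF this]
  \<comment> \<open>The image is Borel because it is a preimage under the inverse affine
    map.\<close>
  have "(\<lambda>x. inv T (x - c)) -` X \<in> sets borel"
    by (rule measurable_sets_borel[of _ borel]) measurable
  also have "(\<lambda>x. inv T (x - c)) -` X = (\<lambda>x. c + T x) ` X"
  proof (intro set_eqI iffI)
    fix x assume "x \<in> (\<lambda>x. inv T (x - c)) -` X"
    moreover have "x = c + T (inv T (x - c))"
      using assms(2) by (simp add: bij_is_surj surj_f_inv_f)
    ultimately show "x \<in> (\<lambda>x. c + T x) ` X" by blast
  next
    fix x assume "x \<in> (\<lambda>x. c + T x) ` X"
    then show "x \<in> (\<lambda>x. inv T (x - c)) -` X"
      using assms(2) by (auto simp: bij_is_inj)
  qed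
  finally show ?thesis .
qed

lemma nn_integral_lborel_translate:
  fixes F :: "'a::euclidean_space \<Rightarrow> ennreal"
  assumes [measurable]: "F \<in> borel_measurable borel"
  shows "(\<integral>\<^sup>+x. F x \<partial>lborel) = (\<integral>\<^sup>+x. F (c + x) \<partial>lborel)"
proof -
  have "(\<integral>\<^sup>+x. F x \<partial>lborel) = (\<integral>\<^sup>+x. F x \<partial>distr lborel borel ((+) c))"
    by (simp only: lborel_distr_plus)
  also have "\<dots> = (\<integral>\<^sup>+x. F (c + x) \<partial>lborel)"
    by (rule nn_integral_distr) auto
  finally show ?thesis .
qed

text \<open>\<open>T\<close> sends the orthonormal basis to \<open>B\<close>. As many independent
  vectors as the dimension span the space, so \<open>T\<close> is surjective and hence
  bijective.\<close>

lemma cone_at_linear_image: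
  fixes c :: "'a::euclidean_space"
  assumes "finite B" "independent B" "card B = DIM('a)"
  obtains T :: "'a \<Rightarrow> 'a" where "linear T" "bij T" "cone_at c B = (\<lambda>x. c + T x) ` nonneg_orthant"
proof -
  obtain e where e: "bij_betw e (Basis :: 'a set) B"
    using assms by (metis finite_Basis finite_same_card_bij)
  define T where "T x = (\<Sum>d\<in>Basis. (x \<bullet> d) *\<^sub>R e d)" for x :: 'a
  have lin: "linear T"
    unfolding T_def by (intro linearI) (simp_all add: algebra_simps sum.distrib scaleR_sum_right)
  have T_coord: "T (\<Sum>d\<in>Basis. w d *\<^sub>R d) = (\<Sum>d\<in>Basis. w d *\<^sub>R e d)" for w
    by (simp add: T_def cong: sum.cong)
  have reindex: "(\<Sum>b\<in>B. u b *\<^sub>R b) = (\<Sum>d\<in>Basis. u (e d) *\<^sub>R e d)" for u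
    using sum.reindex_bij_betw[OF e, of "\<lambda>b. u b *\<^sub>R b"] by simp
  have "span B = UNIV"
    using assms by (metis card_eq_dim dim_UNIV independent_card_le_dim span_UNIV span_subspace subset_UNIV subspace_UNIV top.extremum_uniqueI order_refl)
  then have "\<exists>x. y = T x" for y
  proof -
    have "y \<in> span B" using \<open>span B = UNIV\<close> by simp
    then obtain u where "y = (\<Sum>b\<in>B. u b *\<^sub>R b)"
      using assms(1) by (auto simp: span_finite)
    then show ?thesis by (metis reindex T_coord)
  qed
  then have "surj T" by (auto simp: surj_def)
  then have "bij T" using linear_surjective_imp_injective[OF lin] by (simp add: bij_def)
  moreover have "cone_at c B = (\<lambda>x. c + T x) ` nonneg_orthant"
  proof (intro set_eqI iffI)
    fix y assume "y \<in> cone_at c B"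
    then obtain u where u: "y = c + (\<Sum>d\<in>Basis. u (e d) *\<^sub>R e d)" "\<forall>b\<in>B. 0 \<le> u b"
      unfolding cone_at_def reindex by blast
    have "(\<Sum>d\<in>Basis. u (e d) *\<^sub>R d) \<in> nonneg_orthant"
      using u(2) e by (auto simp: nonneg_orthant_def dest: bij_betwE)
    moreover have "y = c + T (\<Sum>d\<in>Basis. u (e d) *\<^sub>R d)" unfolding T_coord by (rule u)
    ultimately show "y \<in> (\<lambda>x. c + T x) ` nonneg_orthant" by blast
  next
    fix y assume "y \<in> (\<lambda>x. c + T x) ` nonneg_orthant"
    then obtain x where x: "y = c + T x" "\<forall>d\<in>Basis. 0 \<le> x \<bullet> d" by (auto simp: nonneg_orthant_def)
    \<comment> \<open>The coefficient of \<open>b\<close> is the coordinate of \<open>x\<close> at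
      the basis vector that \<open>e\<close> sends to \<open>b\<close>.\<close>
    define u where "u b = x \<bullet> inv_into Basis e b" for b
    have "u (e d) = x \<bullet> d" if "d \<in> Basis" for d
      using e that by (simp add: u_def bij_betw_inv_into_left)
    then have "T x = (\<Sum>b\<in>B. u b *\<^sub>R b)" unfolding reindex T_def by simp
    moreover have "\<forall>b\<in>B. 0 \<le> u b"
      using x(2) bij_betw_inv_into[OF e] by (auto simp: u_def dest: bij_betwE)
    ultimately show "y \<in> cone_at c B"
      unfolding cone_at_def using x(1) by (intro CollectI exI[of _ u]) simp
  qed
  ultimately show ?thesis by (rule that[OF lin])
qed

text \<open>\<open>S\<close> is the adjoint of the inverse of \<open>T\<close>. It is injective
  because \<open>S y\<close> determines \<open>x \<bullet> y = T x \<bullet> S y\<close> for every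
  \<open>x\<close>.\<close>

lemma contragredient_exists:
  fixes T :: "'a::euclidean_space \<Rightarrow> 'a"
  assumes "linear T" "bij T"
  obtains S where "linear S" "bij S" "\<And>x y. T x \<bullet> S y = x \<bullet> y"
proof -
  have lin: "linear (inv T)" using assms by (intro inj_linear_imp_inv_linear) (auto simp: bij_is_inj)
  let ?S = "adjoint (inv T)"
  have dual: "T x \<bullet> ?S y = x \<bullet> y" for x y
    using adjoint_works[OF lin, of "T x" y] assms(2) by (simp add: bij_is_inj)
  have "linear ?S" using lin by (rule adjoint_linear)
  moreover have "inj ?S"
    by (rule injI) (metis dual vector_eq_ldot)
  ultimately show ?thesis
    using that dual linear_injective_imp_surjective[of ?S] by (auto simp: bij_def)
qed

text \<open>The squared coordinates of the geometric mean add up to \<open>x \<bullet> y\<close>.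
  This turns a bound by \<open>\<rho> (sqrt (x \<bullet> y))\<close> into one by the radial function
  \<open>\<rho> (norm z)\<close> at the mean \<open>z\<close>.\<close>

lemma norm_sqrt_coords:
  fixes x y :: "'a::euclidean_space"
  assumes "x \<in> nonneg_orthant" "y \<in> nonneg_orthant"
  shows "norm (\<Sum>b\<in>Basis. sqrt ((x \<bullet> b) * (y \<bullet> b)) *\<^sub>R b) = sqrt (x \<bullet> y)"
proof -
  let ?z = "\<Sum>b\<in>Basis. sqrt ((x \<bullet> b) * (y \<bullet> b)) *\<^sub>R b"
  have "?z \<bullet> ?z = (\<Sum>b\<in>Basis. (?z \<bullet> b) * (?z \<bullet> b))" by (rule euclidean_inner)
  also have "\<dots> = (\<Sum>b\<in>Basis. (x \<bullet> b) * (y \<bullet> b))"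
    using assms by (intro sum.cong) (simp_all add: nonneg_orthant_def)
  also have "\<dots> = x \<bullet> y" by (rule euclidean_inner[symmetric])
  finally show ?thesis by (simp only: norm_eq_sqrt_inner)
qed

text \<open>Pulling \<open>f\<close> back by \<open>c + T x\<close> and \<open>g\<close> back by
  \<open>S y\<close> preserves the scalar product, so the assumed bound becomes the hypothesis of
  the inequality on the orthant.\<close>

lemma santalo_on_cone:
  fixes f g :: "'a::euclidean_space \<Rightarrow> real" and \<rho> :: "real \<Rightarrow> real"
    and T S :: "'a \<Rightarrow> 'a"
  assumes [measurable]: "f \<in> borel_measurable borel" "g \<in> borel_measurable borel"
      "(\<lambda>x::'a. \<rho> (norm x)) \<in> borel_measurable borel"
    and nonneg: "\<And>x. 0 \<le> f x" "\<And>y. 0 \<le> g y" "\<And>r. 0 \<le> r \<Longrightarrow> 0 \<le> \<rho> r"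
    and le: "\<And>x y. 0 \<le> x \<bullet> y \<Longrightarrow> f (c + x) * g y \<le> (\<rho> (sqrt (x \<bullet> y)))\<^sup>2"
    and T: "linear T" "bij T" and S: "linear S" "bij S" and dual: "\<And>x y. T x \<bullet> S y = x \<bullet> y"
  shows "(\<integral>\<^sup>+x. ennreal (f x) * indicator ((\<lambda>x. c + T x) ` nonneg_orthant) x \<partial>lborel)
      * (\<integral>\<^sup>+y. ennreal (g y) * indicator (S ` nonneg_orthant) y \<partial>lborel)
    \<le> (\<integral>\<^sup>+x. ennreal (\<rho> (norm (x::'a))) * indicator nonneg_orthant x \<partial>lborel)\<^sup>2"
proof -
  note [measurable] = borel_measurable_linear_euclidean[OF T(1)]
    borel_measurable_linear_euclidean[OF S(1)]
    bij_linear_image_borel[OF T nonneg_orthant_borel]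
  have [measurable]: "S ` nonneg_orthant \<in> sets borel"
    using bij_linear_image_borel[OF S nonneg_orthant_borel, of 0] by simp
  obtain k :: real where k: "k > 0"
    and kT: "\<And>F. F \<in> borel_measurable borel \<Longrightarrow> (\<integral>\<^sup>+x. F x \<partial>lborel) = ennreal k * (\<integral>\<^sup>+x. F (T x) \<partial>lborel)"
    and kS: "\<And>G. G \<in> borel_measurable borel \<Longrightarrow> (\<integral>\<^sup>+x. G x \<partial>lborel) = ennreal (1 / k) * (\<integral>\<^sup>+x. G (S x) \<partial>lborel)"
    using nn_integral_linear_contragredient[OF T S dual] by metis
  have ind: "indicator ((\<lambda>x. c + T x) ` nonneg_orthant) (c + T x) = (indicator nonneg_orthant x :: ennreal)"
    "indicator (S ` nonneg_orthant) (S x) = (indicator nonneg_orthant x :: ennreal)" for x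
    using T(2) S(2) by (auto simp: indicator_def bij_def inj_eq)
  have f_eq: "(\<integral>\<^sup>+x. ennreal (f x) * indicator ((\<lambda>x. c + T x) ` nonneg_orthant) x \<partial>lborel)
      = ennreal k * (\<integral>\<^sup>+x. ennreal (f (c + T x)) * indicator nonneg_orthant x \<partial>lborel)"
    by (subst nn_integral_lborel_translate[of _ c], measurable, subst kT, measurable, simp only: ind)
  have g_eq: "(\<integral>\<^sup>+y. ennreal (g y) * indicator (S ` nonneg_orthant) y \<partial>lborel)
      = ennreal (1 / k) * (\<integral>\<^sup>+y. ennreal (g (S y)) * indicator nonneg_orthant y \<partial>lborel)"
    by (subst kS, measurable, simp only: ind)
  have "(\<integral>\<^sup>+x. ennreal (f (c + T x)) * indicator nonneg_orthant x \<partial>lborel)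
      * (\<integral>\<^sup>+y. ennreal (g (S y)) * indicator nonneg_orthant y \<partial>lborel)
    \<le> (\<integral>\<^sup>+x. ennreal (\<rho> (norm (x::'a))) * indicator nonneg_orthant x \<partial>lborel)\<^sup>2"
  proof (rule prekopa_leindler_nonneg_orthant)
    fix x y :: 'a assume xy: "x \<in> nonneg_orthant" "y \<in> nonneg_orthant"
    then have "0 \<le> x \<bullet> y"
      by (subst euclidean_inner) (auto simp: nonneg_orthant_def intro!: sum_nonneg)
    then have "f (c + T x) * g (S y) \<le> (\<rho> (sqrt (x \<bullet> y)))\<^sup>2" "0 \<le> \<rho> (sqrt (x \<bullet> y))"
      using le[of "T x" "S y"] nonneg(3) by (simp_all add: dual)
    then show "ennreal (f (c + T x)) * ennreal (g (S y))
        \<le> (ennreal (\<rho> (norm (\<Sum>b\<in>Basis. sqrt ((x \<bullet> b) * (y \<bullet> b)) *\<^sub>R b))))\<^sup>2"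
      by (simp add: norm_sqrt_coords[OF xy] ennreal_power nonneg ennreal_leI flip: ennreal_mult)
  qed measurable
  moreover have "ennreal k * a * (ennreal (1 / k) * b) = a * b" for a b
  proof -
    have "ennreal k * ennreal (1 / k) = 1"
      using k by (simp flip: ennreal_mult)
    then have "(ennreal k * ennreal (1 / k)) * (a * b) = a * b" by simp
    then show ?thesis by (simp only: mult_ac)
  qed
  ultimately show ?thesis
    unfolding f_eq g_eq by simp
qed

theorem mainTheorem3:
  fixes f :: "'a::euclidean_space \<Rightarrow> real" and c :: 'a
  assumes f_meas: "f \<in> borel_measurable borel"
    and f_nonneg: "\<And>x. f x \<ge> 0"
    and f_int: "integrable lborel f"
    and center: "yao_yao_center (density lborel (\<lambda>x. ennreal (f x))) c"
  shows "\<forall>\<rho> g. weight \<rho> \<longrightarrow> g \<in> borel_measurable (borel :: 'a measure)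
           \<longrightarrow> (\<forall>y. g y \<ge> 0)
           \<longrightarrow> (\<forall>x y. x \<bullet> y \<ge> 0 \<longrightarrow> f (c + x) * g y \<le> (\<rho> (sqrt (x \<bullet> y)))\<^sup>2)
           \<longrightarrow> (\<integral>\<^sup>+ x. ennreal (f x) \<partial>lborel) * (\<integral>\<^sup>+ y. ennreal (g y) \<partial>lborel)
               \<le> (\<integral>\<^sup>+ x. ennreal (\<rho> (norm (x::'a))) \<partial>lborel)\<^sup>2"
proof (intro allI impI)
  fix \<rho> :: "real \<Rightarrow> real" and g :: "'a \<Rightarrow> real"
  assume \<rho>: "weight \<rho>" and g_meas: "g \<in> borel_measurable borel" and g_nonneg: "\<forall>y. g y \<ge> 0"
    and le: "\<forall>x y. x \<bullet> y \<ge> 0 \<longrightarrow> f (c + x) * g y \<le> (\<rho> (sqrt (x \<bullet> y)))\<^sup>2"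
  note [measurable] = f_meas g_meas
  have \<rho>_nonneg: "0 \<le> \<rho> r" if "0 \<le> r" for r using \<rho> that by (simp add: weight_def)
  \<comment> \<open>A weight is measurable only on the half-line \<open>{0..}\<close>, which
    contains all values of \<open>norm\<close>.\<close>
  have \<rho>_meas [measurable]: "(\<lambda>x::'a. \<rho> (norm x)) \<in> borel_measurable borel"
  proof -
    have "(norm :: 'a \<Rightarrow> real) \<in> borel \<rightarrow>\<^sub>M restrict_space borel {0..}"
      by (intro measurable_restrict_space2) auto
    moreover have "\<rho> \<in> borel_measurable (restrict_space borel {0..})"
      using \<rho> by (simp add: weight_def)
    ultimately show ?thesis by (rule measurable_compose)
  qed
  let ?I = "\<integral>\<^sup>+x. ennreal (f x) \<partial>lborel"
  let ?R = "\<integral>\<^sup>+x. ennreal (\<rho> (norm (x::'a))) * indicator nonneg_orthant x \<partial>lborel"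
  let ?n = "DIM('a)"
  obtain P where P: "yao_yao UNIV P c"
    and P_equi: "\<And>A. A \<in> P \<Longrightarrow> emeasure (density lborel (\<lambda>x. ennreal (f x))) A
      = emeasure (density lborel (\<lambda>x. ennreal (f x))) UNIV / 2 ^ ?n"
    using center unfolding yao_yao_center_def yao_yao_equipartition_def by blast
  have "finite P" and card_P: "card P \<le> 2 ^ ?n"
    using yao_yao_structure[OF P] by auto
  \<comment> \<open>The dual cone of the cell seen from \<open>c\<close>, in the form in which
    \<open>yao_yao_dual_cover\<close> provides it.\<close>
  define D where "D A = {y. \<forall>x\<in>A. 0 \<le> (x - c) \<bullet> y}" for A
  \<comment> \<open>\<open>D'\<close> is the image of the orthant under \<open>S\<close>. A Borel
    superset of the dual cone is enough for covering the space, so only one inclusion is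
    proved.\<close>
  have cell: "\<exists>D'. D A \<subseteq> D' \<and> D' \<in> sets borel \<and>
      ?I * (\<integral>\<^sup>+y. ennreal (g y) * indicator D' y \<partial>lborel) \<le> 2 ^ ?n * ?R\<^sup>2" if A_in: "A \<in> P" for A
  proof -
    have "\<forall>A\<in>P. \<exists>B. finite B \<and> independent B \<and> card B = ?n \<and> A = cone_at c B"
      using yao_yao_structure[OF P] by simp
    then obtain B where B: "finite B" "independent B" "card B = ?n" and A_cone: "A = cone_at c B"
      using A_in by blast
    obtain T :: "'a \<Rightarrow> 'a" where T: "linear T" "bij T"
      and A_eq: "A = (\<lambda>x. c + T x) ` nonneg_orthant"
      using cone_at_linear_image[OF B, of c] unfolding A_cone by blast
    obtain S where S: "linear S" "bij S" and dual: "\<And>x y. T x \<bullet> S y = x \<bullet> y"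
      using contragredient_exists[OF T] by metis
    have "D A \<subseteq> S ` nonneg_orthant"
    proof
      fix y assume y: "y \<in> D A"
      obtain z where z: "y = S z" using S(2) by (metis bij_pointE)
      \<comment> \<open>The edge vectors \<open>T b\<close> of the cell test the coordinates of
        \<open>z\<close>, because \<open>T b \<bullet> S z = b \<bullet> z\<close>.\<close>
      have "0 \<le> z \<bullet> b" if b: "b \<in> Basis" for b
      proof -
        have "b \<in> nonneg_orthant" using b by (auto simp: nonneg_orthant_def inner_Basis)
        then have "c + T b \<in> A" unfolding A_eq by blast
        then have "0 \<le> T b \<bullet> S z" using y z unfolding D_def by force
        then show ?thesis unfolding dual by (subst inner_commute)
      qed
      then show "y \<in> S ` nonneg_orthant" unfolding z nonneg_orthant_def by blast
    qed
    moreover have "S ` nonneg_orthant \<in> sets borel"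
      using bij_linear_image_borel[OF S nonneg_orthant_borel, of 0] by simp
    moreover have "?I * (\<integral>\<^sup>+y. ennreal (g y) * indicator (S ` nonneg_orthant) y \<partial>lborel) \<le> 2 ^ ?n * ?R\<^sup>2"
    proof -
      have A_borel: "A \<in> sets borel"
        unfolding A_eq by (rule bij_linear_image_borel[OF T nonneg_orthant_borel])
      have "(\<integral>\<^sup>+x. ennreal (f x) * indicator A x \<partial>lborel) = ?I / 2 ^ ?n"
        using P_equi[OF A_in] A_borel by (simp add: emeasure_density)
      \<comment> \<open>The equipartition is solved for the total mass, as \<open>2 ^ ?n\<close> is
        finite and nonzero; this brings the first factor \<open>2 ^ ?n\<close> into the
        bound.\<close>
      then have "?I = 2 ^ ?n * (\<integral>\<^sup>+x. ennreal (f x) * indicator A x \<partial>lborel)"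
        by (simp add: ennreal_times_divide mult_divide_eq_ennreal mult.commute power_eq_top_ennreal)
      moreover have "(\<integral>\<^sup>+x. ennreal (f x) * indicator A x \<partial>lborel)
          * (\<integral>\<^sup>+y. ennreal (g y) * indicator (S ` nonneg_orthant) y \<partial>lborel) \<le> ?R\<^sup>2"
        unfolding A_eq using f_nonneg g_nonneg \<rho>_nonneg le
        by (intro santalo_on_cone T S dual) auto
      ultimately show ?thesis by (simp only: mult.assoc) (rule mult_left_mono, auto)
    qed
    ultimately show ?thesis by blast
  qed
  then have "\<forall>A\<in>P. \<exists>D'. D A \<subseteq> D' \<and> D' \<in> sets borel \<and>
      ?I * (\<integral>\<^sup>+y. ennreal (g y) * indicator D' y \<partial>lborel) \<le> 2 ^ ?n * ?R\<^sup>2"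
    by (rule ballI)
  from bchoice[OF this] obtain D' where "\<forall>A\<in>P. D A \<subseteq> D' A \<and> D' A \<in> sets borel \<and>
      ?I * (\<integral>\<^sup>+y. ennreal (g y) * indicator (D' A) y \<partial>lborel) \<le> 2 ^ ?n * ?R\<^sup>2" ..
  then have D': "\<And>A. A \<in> P \<Longrightarrow> D A \<subseteq> D' A" "\<And>A. A \<in> P \<Longrightarrow> D' A \<in> sets borel"
    and cell': "\<And>A. A \<in> P \<Longrightarrow> ?I * (\<integral>\<^sup>+y. ennreal (g y) * indicator (D' A) y \<partial>lborel) \<le> 2 ^ ?n * ?R\<^sup>2"
    by simp_all
  \<comment> \<open>The sets \<open>D' A\<close> cover the space, and overlaps only enlarge the
    sum.\<close>
  have "?I * (\<integral>\<^sup>+y. ennreal (g y) \<partial>lborel)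
      \<le> ?I * (\<integral>\<^sup>+y. (\<Sum>A\<in>P. ennreal (g y) * indicator (D' A) y) \<partial>lborel)"
  proof (intro mult_left_mono nn_integral_mono)
    fix y
    obtain A where A: "A \<in> P" "y \<in> D A"
      using yao_yao_dual_cover[OF P, of y] by (auto simp: D_def)
    then have "y \<in> D' A" using D'(1) by blast
    then have "ennreal (g y) = ennreal (g y) * indicator (D' A) y" by simp
    also have "\<dots> \<le> (\<Sum>A\<in>P. ennreal (g y) * indicator (D' A) y)"
      using A(1) \<open>finite P\<close> by (intro member_le_sum) auto
    finally show "ennreal (g y) \<le> (\<Sum>A\<in>P. ennreal (g y) * indicator (D' A) y)" .
  qed simp
  also have "\<dots> = (\<Sum>A\<in>P. ?I * (\<integral>\<^sup>+y. ennreal (g y) * indicator (D' A) y \<partial>lborel))"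
    using D'(2) by (subst nn_integral_sum) (auto simp: sum_distrib_left)
  also have "\<dots> \<le> (\<Sum>A\<in>P. 2 ^ ?n * ?R\<^sup>2)"
    by (intro sum_mono cell')
  \<comment> \<open>The second factor \<open>2 ^ ?n\<close> bounds the number of cells.\<close>
  also have "\<dots> \<le> 2 ^ ?n * (2 ^ ?n * ?R\<^sup>2)"
  proof -
    have "of_nat (card P) \<le> (of_nat (2 ^ ?n) :: ennreal)" using card_P by (rule of_nat_mono)
    then show ?thesis by (simp add: mult_right_mono)
  qed
  \<comment> \<open>Each factor \<open>2 ^ ?n\<close> completes one \<open>?R\<close> to the
    integral over the whole space, since coordinatewise absolute values preserve the norm.\<close>
  also have "\<dots> = (\<integral>\<^sup>+x. ennreal (\<rho> (norm (x::'a))) \<partial>lborel)\<^sup>2"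
  proof -
    have "norm (\<Sum>b\<in>Basis. \<bar>x \<bullet> b\<bar> *\<^sub>R b) = norm x" for x :: 'a
    proof -
      let ?z = "\<Sum>b\<in>Basis. \<bar>x \<bullet> b\<bar> *\<^sub>R b"
      have "?z \<bullet> ?z = (\<Sum>b\<in>Basis. (?z \<bullet> b) * (?z \<bullet> b))" by (rule euclidean_inner)
      also have "\<dots> = (\<Sum>b\<in>Basis. (x \<bullet> b) * (x \<bullet> b))"
        by (intro sum.cong) simp_all
      also have "\<dots> = x \<bullet> x" by (rule euclidean_inner[symmetric])
      finally show ?thesis by (simp only: norm_eq_sqrt_inner)
    qed
    then have "(\<integral>\<^sup>+x. ennreal (\<rho> (norm (x::'a))) \<partial>lborel) = 2 ^ ?n * ?R"
      by (intro nn_integral_even_orthant) auto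
    then show ?thesis by (simp add: power_mult_distrib power2_eq_square mult_ac)
  qed
  finally show "?I * (\<integral>\<^sup>+ y. ennreal (g y) \<partial>lborel) \<le> (\<integral>\<^sup>+ x. ennreal (\<rho> (norm (x::'a))) \<partial>lborel)\<^sup>2" .
qed

end
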